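(* Let $P\in\mathbb{C}[x_1,\ldots,x_n]$ be a polynomial of degree $d\ge1$ that factors as a product of linear forms. Then a matrix $C=(c_{ij})\in\mathbb{C}^{n\times n}$ belongs to the Lie algebra of $P$ if and only if $$\sum_{i,j\in[n]}c_{ij}x_j\frac{\partial P}{\partial x_i}(x)=0\quad\text{for every }x\in\Lambda(d,n).$$ In particular, a basis of the Lie algebra of $P$ can be computed deterministically in polynomial time with black box access to $P$.
   Context: The Lie algebra of $P\in\mathbb{C}[x_1,\ldots,x_n]$ is the subspace of matrices $C\in M_n(\mathbb{C})$ satisfying the polynomial identity $\sum_{i,j\in[n]}c_{ij}x_j\,\partial P/\partial x_i=0$. For $n,k\in\mathbb{N}$, $\mathcal{P}(n,k)\subseteq\mathbb{C}^n$ is the set of $k(n-1)+1$ points $(1,t,t^2,\ldots,t^{n-1})$ for $t=1,2,\ldots,k(n-1)+1$. For $m,n\ge1$, $\Lambda(m,n)=\{u+\lambda v: v\in\mathcal{P}(n,m),\ u\in\mathcal{P}(n,m^2)\cup\{0\},\ \lambda\in\{1,\ldots,2m+1\}\}$. *)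

theory Defs
  imports Complex_Main "HOL-Library.Poly_Mapping" "Jordan_Normal_Form.VS_Connect"
begin

section \<open>Multivariate polynomials\<close>

text \<open>A polynomial maps exponent vectors (finitely supported, indexed by variable numbers) to
  coefficients. The variables are numbered from 0, so the variables of a polynomial in \<open>n\<close>
  variables are \<open>0, \<dots>, n - 1\<close>.\<close>

type_synonym mpoly = "(nat \<Rightarrow>\<^sub>0 nat) \<Rightarrow>\<^sub>0 complex"

definition mconst :: "complex \<Rightarrow> mpoly" where
  "mconst c = Poly_Mapping.single 0 c"

definition mvar :: "nat \<Rightarrow> mpoly" where
  "mvar i = Poly_Mapping.single (Poly_Mapping.single i 1) 1"

definition mpoly_in :: "nat \<Rightarrow> mpoly \<Rightarrow> bool" where
  "mpoly_in n P \<longleftrightarrow> (\<forall>m \<in> Poly_Mapping.keys P. Poly_Mapping.keys m \<subseteq> {..<n})"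

definition meval :: "mpoly \<Rightarrow> (nat \<Rightarrow> complex) \<Rightarrow> complex" where
  "meval P x = (\<Sum>m \<in> Poly_Mapping.keys P.
     Poly_Mapping.lookup P m * (\<Prod>i \<in> Poly_Mapping.keys m. x i ^ Poly_Mapping.lookup m i))"

text \<open>The zero polynomial gets degree 0.\<close>

definition total_degree :: "mpoly \<Rightarrow> nat" where
  "total_degree P = Max (insert 0 ((\<lambda>m. \<Sum>i \<in> Poly_Mapping.keys m. Poly_Mapping.lookup m i)
     ` Poly_Mapping.keys P))"

text \<open>Subtraction of exponents is truncated, but a monomial without the variable \<open>i\<close> gets the
  coefficient 0 anyway.\<close>

definition mderiv :: "nat \<Rightarrow> mpoly \<Rightarrow> mpoly" where
  "mderiv i P = (\<Sum>m \<in> Poly_Mapping.keys P.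
     Poly_Mapping.single (m - Poly_Mapping.single i 1)
       (of_nat (Poly_Mapping.lookup m i) * Poly_Mapping.lookup P m))"

definition linear_form :: "nat \<Rightarrow> mpoly \<Rightarrow> bool" where
  "linear_form n l \<longleftrightarrow> (\<exists>a. l = (\<Sum>i<n. mconst (a i) * mvar i))"

definition product_of_linear_forms :: "nat \<Rightarrow> mpoly \<Rightarrow> bool" where
  "product_of_linear_forms n P \<longleftrightarrow> (\<exists>ls. (\<forall>l \<in> set ls. linear_form n l) \<and> P = prod_list ls)"

section \<open>The Lie algebra of a polynomial and the point set\<close>

definition lie_algebra :: "nat \<Rightarrow> mpoly \<Rightarrow> complex mat set" where
  "lie_algebra n P = {C \<in> carrier_mat n n.
     (\<Sum>i<n. \<Sum>j<n. mconst (C $$ (i, j)) * mvar j * mderiv i P) = 0}"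

definition is_lie_algebra_basis :: "nat \<Rightarrow> mpoly \<Rightarrow> complex mat set \<Rightarrow> bool" where
  "is_lie_algebra_basis n P B \<longleftrightarrow>
     vectorspace.basis class_ring ((module_mat TYPE(complex) n n)\<lparr>carrier := lie_algebra n P\<rparr>) B"

definition moment_points :: "nat \<Rightarrow> nat \<Rightarrow> complex vec set" where
  "moment_points n k = (\<lambda>t. vec n (\<lambda>i. of_nat t ^ i)) ` {1..k * (n - 1) + 1}"

definition Lambda_points :: "nat \<Rightarrow> nat \<Rightarrow> complex vec set" where
  "Lambda_points m n = {u + of_nat l \<cdot>\<^sub>v v | u l v.
     v \<in> moment_points n m \<and> u \<in> moment_points n (m\<^sup>2) \<union> {0\<^sub>v n} \<and> l \<in> {1..2 * m + 1}}"

section \<open>Uniform arithmetic computation with a black box\<close>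

text \<open>Programs of an arithmetic random access machine over the complex numbers (in the style of
  Blum, Shub and Smale). The memory consists of natural-number registers and of arrays of complex
  numbers. Complex numbers can be added, subtracted, multiplied, divided and tested for equality,
  each at unit cost, and the only constants are natural numbers; reals and imaginary parts,
  comparisons and roots are not available. The black box evaluates the
  unknown polynomial at the point stored in an array.

  Natural numbers serve as counters and array indices. Every evaluation of a natural-number
  expression is charged the values of all its subexpressions, i.e. natural numbers are
  charged in unary. This rules out fast arithmetic on huge integers; all natural numbers and
  addresses that occur are bounded by the initial values plus the running time.\<close>

type_synonym vname = string

datatype nexp = NConst nat | NReg vname | NAdd nexp nexp | NSub nexp nexp | NMul nexp nexp

datatype cexp = COfNat nexp | CElem vname nexp
  | CAdd cexp cexp | CSub cexp cexp | CMul cexp cexp | CDiv cexp cexp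

datatype bexp = BLess nexp nexp | BEq cexp cexp | BNot bexp | BAnd bexp bexp

datatype com =
    Skip
  | SetReg vname nexp
  | SetElem vname nexp cexp
  | Query vname nexp vname
  | Then com com
  | Cond bexp com com
  | While bexp com

record state =
  reg :: "vname \<Rightarrow> nat"
  arr :: "vname \<Rightarrow> nat \<Rightarrow> complex"

fun nval :: "nexp \<Rightarrow> state \<Rightarrow> nat" where
  "nval (NConst k) s = k"
| "nval (NReg x) s = reg s x"
| "nval (NAdd a b) s = nval a s + nval b s"
| "nval (NSub a b) s = nval a s - nval b s"
| "nval (NMul a b) s = nval a s * nval b s"

fun ncost :: "nexp \<Rightarrow> state \<Rightarrow> nat" where
  "ncost (NConst k) s = 1 + k"
| "ncost (NReg x) s = 1 + reg s x"
| "ncost (NAdd a b) s = 1 + ncost a s + ncost b s + (nval a s + nval b s)"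
| "ncost (NSub a b) s = 1 + ncost a s + ncost b s + (nval a s - nval b s)"
| "ncost (NMul a b) s = 1 + ncost a s + ncost b s + nval a s * nval b s"

text \<open>Division by 0 yields 0, as everywhere in HOL; programs can test for 0 beforehand.\<close>

fun cval :: "cexp \<Rightarrow> state \<Rightarrow> complex" where
  "cval (COfNat e) s = of_nat (nval e s)"
| "cval (CElem a e) s = arr s a (nval e s)"
| "cval (CAdd f g) s = cval f s + cval g s"
| "cval (CSub f g) s = cval f s - cval g s"
| "cval (CMul f g) s = cval f s * cval g s"
| "cval (CDiv f g) s = cval f s / cval g s"

fun ccost :: "cexp \<Rightarrow> state \<Rightarrow> nat" where
  "ccost (COfNat e) s = 1 + ncost e s"
| "ccost (CElem a e) s = 1 + ncost e s"
| "ccost (CAdd f g) s = 1 + ccost f s + ccost g s"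
| "ccost (CSub f g) s = 1 + ccost f s + ccost g s"
| "ccost (CMul f g) s = 1 + ccost f s + ccost g s"
| "ccost (CDiv f g) s = 1 + ccost f s + ccost g s"

fun bval :: "bexp \<Rightarrow> state \<Rightarrow> bool" where
  "bval (BLess a b) s \<longleftrightarrow> nval a s < nval b s"
| "bval (BEq f g) s \<longleftrightarrow> cval f s = cval g s"
| "bval (BNot b) s \<longleftrightarrow> \<not> bval b s"
| "bval (BAnd b c) s \<longleftrightarrow> bval b s \<and> bval c s"

fun bcost :: "bexp \<Rightarrow> state \<Rightarrow> nat" where
  "bcost (BLess a b) s = 1 + ncost a s + ncost b s"
| "bcost (BEq f g) s = 1 + ccost f s + ccost g s"
| "bcost (BNot b) s = 1 + bcost b s"
| "bcost (BAnd b c) s = 1 + bcost b s + bcost c s"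

text \<open>\<open>run f c s t s'\<close>: with black box \<open>f\<close>, the program \<open>c\<close> started in state \<open>s\<close> halts after
  time \<open>t\<close> in state \<open>s'\<close>. In \<open>Query a e b\<close> the point is \<open>(b[0], b[1], \<dots>)\<close> and the answer goes
  to \<open>a[e]\<close>; when \<open>f\<close> evaluates a polynomial in \<open>n\<close> variables, only the first \<open>n\<close> entries of
  \<open>b\<close> matter.\<close>

inductive run :: "((nat \<Rightarrow> complex) \<Rightarrow> complex) \<Rightarrow> com \<Rightarrow> state \<Rightarrow> nat \<Rightarrow> state \<Rightarrow> bool"
  for f :: "(nat \<Rightarrow> complex) \<Rightarrow> complex" where
  Skip: "run f Skip s 1 s"
| SetReg: "run f (SetReg x e) s (1 + ncost e s) (s\<lparr>reg := (reg s)(x := nval e s)\<rparr>)"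
| SetElem: "run f (SetElem a e g) s (1 + ncost e s + ccost g s)
    (s\<lparr>arr := (arr s)(a := (arr s a)(nval e s := cval g s))\<rparr>)"
| Query: "run f (Query a e b) s (1 + ncost e s)
    (s\<lparr>arr := (arr s)(a := (arr s a)(nval e s := f (arr s b)))\<rparr>)"
| Then: "run f c1 s t1 s1 \<Longrightarrow> run f c2 s1 t2 s2 \<Longrightarrow> run f (Then c1 c2) s (t1 + t2) s2"
| CondTrue: "bval b s \<Longrightarrow> run f c1 s t s' \<Longrightarrow> run f (Cond b c1 c2) s (1 + bcost b s + t) s'"
| CondFalse: "\<not> bval b s \<Longrightarrow> run f c2 s t s' \<Longrightarrow> run f (Cond b c1 c2) s (1 + bcost b s + t) s'"
| WhileFalse: "\<not> bval b s \<Longrightarrow> run f (While b c) s (1 + bcost b s) s"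
| WhileTrue: "bval b s \<Longrightarrow> run f c s t1 s1 \<Longrightarrow> run f (While b c) s1 t2 s2 \<Longrightarrow>
    run f (While b c) s (1 + bcost b s + t1 + t2) s2"

inductive_cases SkipE: "run f Skip s t s'"
inductive_cases SetRegE: "run f (SetReg x e) s t s'"
inductive_cases SetElemE: "run f (SetElem a e g) s t s'"
inductive_cases QueryE: "run f (Query a e b) s t s'"
inductive_cases ThenE: "run f (Then c1 c2) s t s'"
inductive_cases CondE: "run f (Cond b c1 c2) s t s'"
inductive_cases WhileE: "run f (While b c) s t s'"

lemma run_deterministic:
  "run f c s t s' \<Longrightarrow> run f c s u s'' \<Longrightarrow> u = t \<and> s'' = s'"
proof (induction arbitrary: u s'' rule: run.induct)
  case (Then c1 s t1 s1 c2 t2 s2)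
  from Then.prems show ?case
    by (rule ThenE) (auto dest: Then.IH)
next
  case (CondTrue b s c1 t s' c2)
  from CondTrue.prems show ?case
    by (rule CondE) (use CondTrue.hyps in \<open>auto dest: CondTrue.IH\<close>)
next
  case (CondFalse b s c2 t s' c1)
  from CondFalse.prems show ?case
    by (rule CondE) (use CondFalse.hyps in \<open>auto dest: CondFalse.IH\<close>)
next
  case (WhileFalse b s c)
  from WhileFalse.prems show ?case
    by (rule WhileE) (use WhileFalse.hyps in auto)
next
  case (WhileTrue b s c t1 s1 t2 s2)
  from WhileTrue.prems show ?case
    by (rule WhileE) (use WhileTrue.hyps in \<open>auto dest: WhileTrue.IH\<close>)
qed (auto elim: SkipE SetRegE SetElemE QueryE)

text \<open>The input consists of the number of variables and the degree; everything else is 0. The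
  output is a sequence of \<open>n \<times> n\<close> matrices, its length in register \<open>r\<close> and the entries in
  array \<open>out\<close>, matrix after matrix and row after row.\<close>

definition init_state :: "nat \<Rightarrow> nat \<Rightarrow> state" where
  "init_state n d = \<lparr>reg = (\<lambda>_. 0)(''n'' := n, ''d'' := d), arr = (\<lambda>_ _. 0)\<rparr>"

definition output_length :: "state \<Rightarrow> nat" where
  "output_length s = reg s ''r''"

definition output_matrix :: "nat \<Rightarrow> state \<Rightarrow> nat \<Rightarrow> complex mat" where
  "output_matrix n s q = mat n n (\<lambda>(i, j). arr s ''out'' (q * n * n + i * n + j))"

definition outputs_lie_algebra_basis :: "nat \<Rightarrow> mpoly \<Rightarrow> state \<Rightarrow> bool" where
  "outputs_lie_algebra_basis n P s \<longleftrightarrow>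
     inj_on (output_matrix n s) {..<output_length s} \<and>
     is_lie_algebra_basis n P (output_matrix n s ` {..<output_length s})"

end

theory Submission
  imports Defs "HOL-Computational_Algebra.Polynomial"
begin

text \<open>Write \<open>P = \<Prod> l\<^sub>k\<close> and \<open>m\<^sub>k(x) = l\<^sub>k(C x)\<close>, so that the derivative of \<open>P\<close> along \<open>C\<close> is
  \<open>D = \<Sum> m\<^sub>k \<Prod>\<^bsub>j \<noteq> k\<^esub> l\<^sub>j\<close>. A linear form that is not 0 vanishes at few points of the moment curve; hence
  some \<open>v\<close> avoids the zeros of all \<open>l\<^sub>k\<close>, and some \<open>u\<close> then avoids the zeros of all nonzero
  forms \<open>l\<^sub>k(v) l\<^sub>i - l\<^sub>i(v) l\<^sub>k\<close> and \<open>l\<^sub>i(v) m\<^sub>i - m\<^sub>i(v) l\<^sub>i\<close>. If \<open>D\<close> vanishes at sufficiently many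
  points of the line \<open>u + \<lambda> v\<close>, then it vanishes on the line. On the line, the factors not proportional to
  \<open>l\<^sub>i\<close> do not vanish at the root of \<open>l\<^sub>i\<close>, so \<open>m\<^sub>i\<close> vanishes there, which by the choice of \<open>u\<close> makes
  \<open>m\<^sub>i = \<mu>\<^sub>i l\<^sub>i\<close>. Now \<open>D = (\<Sum> \<mu>\<^sub>k) P\<close>, and \<open>D(v) = 0\<close> gives \<open>D = 0\<close>.

  The algorithm starts from the unit matrices and cuts the space by one linear condition on \<open>C\<close> per
  point, exchanging a pivot of the current basis in each step. The value of such a condition at
  a basis matrix \<open>B\<close> is a directional derivative of \<open>P\<close> along \<open>B x\<close>, obtained from \<open>d + 1\<close> values of the
  black box.\<close>

section \<open>Evaluation and derivatives of polynomials\<close>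

text \<open>Reduces identities that are additive in each factor, such as the product rules below, to
  single monomials.\<close>

lemma mpoly_monomials: "P = (\<Sum>m\<in>Poly_Mapping.keys P. Poly_Mapping.single m (Poly_Mapping.lookup P m))"
  for P :: mpoly
  by (rule poly_mapping_eqI) (auto simp: lookup_sum lookup_single when_def in_keys_iff sum.delta' cong: if_cong)

text \<open>Summands outside the support are 0, so polynomials with different supports can be
  evaluated over one common index set.\<close>

lemma meval_superset:
  assumes "finite A" "Poly_Mapping.keys P \<subseteq> A"
  shows "meval P x = (\<Sum>m \<in> A.
     Poly_Mapping.lookup P m * (\<Prod>i \<in> Poly_Mapping.keys m. x i ^ Poly_Mapping.lookup m i))"
  unfolding meval_def by (rule sum.mono_neutral_left) (use assms in \<open>auto simp: in_keys_iff\<close>)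

lemma meval_zero [simp]: "meval 0 x = 0"
  by (simp add: meval_def)

lemma meval_add: "meval (P + Q) x = meval P x + meval Q x"
proof -
  let ?A = "Poly_Mapping.keys P \<union> Poly_Mapping.keys Q"
  have "Poly_Mapping.keys (P + Q) \<subseteq> ?A" by (rule keys_add)
  then show ?thesis
    by (simp add: meval_superset[of ?A] lookup_add ring_distribs sum.distrib)
qed

lemma meval_sum: "meval (sum f A) x = (\<Sum>a\<in>A. meval (f a) x)"
  by (induction A rule: infinite_finite_induct) (auto simp: meval_add)

lemma meval_single: "meval (Poly_Mapping.single m c) x =
   c * (\<Prod>i \<in> Poly_Mapping.keys m. x i ^ Poly_Mapping.lookup m i)"
  by (auto simp: meval_def)

lemma monomial_prod_superset:
  fixes x :: "nat \<Rightarrow> complex"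
  assumes "finite A" "Poly_Mapping.keys m \<subseteq> A"
  shows "(\<Prod>i \<in> Poly_Mapping.keys m. x i ^ Poly_Mapping.lookup m i) = (\<Prod>i \<in> A. x i ^ Poly_Mapping.lookup m i)"
  by (rule prod.mono_neutral_left) (use assms in \<open>auto simp: in_keys_iff\<close>)

lemma meval_mult_single:
  "meval (Poly_Mapping.single m c * Poly_Mapping.single m' c') x =
   meval (Poly_Mapping.single m c) x * meval (Poly_Mapping.single m' c') x"
proof -
  let ?A = "Poly_Mapping.keys m \<union> Poly_Mapping.keys m'"
  have "Poly_Mapping.keys (m + m') \<subseteq> ?A" by (rule keys_add)
  then have "(\<Prod>i \<in> Poly_Mapping.keys (m + m'). x i ^ Poly_Mapping.lookup (m + m') i) =
      (\<Prod>i\<in>?A. x i ^ Poly_Mapping.lookup (m + m') i)"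
    by (intro monomial_prod_superset) auto
  then show ?thesis
    by (simp add: mult_single meval_single monomial_prod_superset[of ?A] lookup_add
        power_add prod.distrib del: prod.infinite)
qed

lemma meval_mult: "meval (P * Q) x = meval P x * meval Q x"
proof -
  let ?s = "\<lambda>P m. Poly_Mapping.single m (Poly_Mapping.lookup P m) :: mpoly"
  let ?P = "\<Sum>m\<in>Poly_Mapping.keys P. ?s P m" and ?Q = "\<Sum>m\<in>Poly_Mapping.keys Q. ?s Q m"
  have "meval (?P * ?Q) x = meval ?P x * meval ?Q x"
    by (simp add: sum_product meval_sum meval_mult_single)
  then show ?thesis by (simp only: mpoly_monomials[symmetric])
qed

lemma meval_mconst [simp]: "meval (mconst c) x = c"
  by (simp add: mconst_def meval_single)

lemma meval_one [simp]: "meval 1 x = 1"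
  using meval_mconst[of 1 x] by (simp add: mconst_def)

lemma meval_mvar [simp]: "meval (mvar i) x = x i"
  by (simp add: mvar_def meval_single)

lemma meval_prod: "meval (prod f A) x = (\<Prod>a\<in>A. meval (f a) x)"
  by (induction A rule: infinite_finite_induct) (auto simp: meval_mult)

section \<open>Formal partial derivatives\<close>

lemma mderiv_superset:
  assumes "finite A" "Poly_Mapping.keys P \<subseteq> A"
  shows "mderiv i P = (\<Sum>m \<in> A. Poly_Mapping.single (m - Poly_Mapping.single i 1)
       (of_nat (Poly_Mapping.lookup m i) * Poly_Mapping.lookup P m))"
  unfolding mderiv_def by (rule sum.mono_neutral_left) (use assms in \<open>auto simp: in_keys_iff\<close>)

lemma mderiv_zero [simp]: "mderiv i 0 = 0"
  by (simp add: mderiv_def)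

lemma mderiv_add: "mderiv i (P + Q) = mderiv i P + mderiv i Q"
proof -
  let ?A = "Poly_Mapping.keys P \<union> Poly_Mapping.keys Q"
  have "Poly_Mapping.keys (P + Q) \<subseteq> ?A" by (rule keys_add)
  then show ?thesis
    by (simp add: mderiv_superset[of ?A] lookup_add ring_distribs sum.distrib single_add)
qed

lemma mderiv_sum: "mderiv i (sum f A) = (\<Sum>a\<in>A. mderiv i (f a))"
  by (induction A rule: infinite_finite_induct) (auto simp: mderiv_add)

lemma mderiv_single: "mderiv i (Poly_Mapping.single m c) =
   Poly_Mapping.single (m - Poly_Mapping.single i 1) (of_nat (Poly_Mapping.lookup m i) * c)"
  by (auto simp: mderiv_def)

text \<open>Since the exponent of \<open>i\<close> in \<open>m\<close> is positive, the truncated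
  subtraction takes nothing from \<open>m'\<close>.\<close>

lemma exponent_shift:
  fixes m m' :: "nat \<Rightarrow>\<^sub>0 nat"
  assumes "Poly_Mapping.lookup m i \<noteq> 0"
  shows "m + m' - Poly_Mapping.single i 1 = (m - Poly_Mapping.single i 1) + m'"
  by (rule poly_mapping_eqI) (use assms in \<open>auto simp: lookup_add lookup_minus lookup_single when_def\<close>)

lemma mderiv_mult_single:
  "mderiv i (Poly_Mapping.single m c * Poly_Mapping.single m' c') =
   mderiv i (Poly_Mapping.single m c) * Poly_Mapping.single m' c' +
   Poly_Mapping.single m c * mderiv i (Poly_Mapping.single m' c')"
proof -
  \<comment> \<open>If \<open>i\<close> does not occur in \<open>m\<close>, the two monomials may
    differ, but then the coefficient is 0.\<close>
  have 1: "Poly_Mapping.single (m + m' - Poly_Mapping.single i 1) (of_nat (Poly_Mapping.lookup m i) * c * c')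
     = Poly_Mapping.single (m - Poly_Mapping.single i 1 + m') (of_nat (Poly_Mapping.lookup m i) * c * c')"
    by (cases "Poly_Mapping.lookup m i = 0") (use exponent_shift[of m i m'] in auto)
  have 2: "Poly_Mapping.single (m + m' - Poly_Mapping.single i 1) (of_nat (Poly_Mapping.lookup m' i) * c * c')
     = Poly_Mapping.single (m + (m' - Poly_Mapping.single i 1)) (of_nat (Poly_Mapping.lookup m' i) * c * c')"
    by (cases "Poly_Mapping.lookup m' i = 0") (use exponent_shift[of m' i m] in \<open>auto simp: add.commute\<close>)
  show ?thesis
    using 1 2 by (simp add: mult_single mderiv_single lookup_add algebra_simps single_add)
qed

lemma mderiv_mult: "mderiv i (P * Q) = mderiv i P * Q + P * mderiv i Q"
proof -
  let ?s = "\<lambda>P m. Poly_Mapping.single m (Poly_Mapping.lookup P m) :: mpoly"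
  let ?P = "\<Sum>m\<in>Poly_Mapping.keys P. ?s P m" and ?Q = "\<Sum>m\<in>Poly_Mapping.keys Q. ?s Q m"
  have "mderiv i (?P * ?Q) = mderiv i ?P * ?Q + ?P * mderiv i ?Q"
    by (simp add: sum_product mderiv_sum mderiv_mult_single sum.distrib)
  then show ?thesis by (simp only: mpoly_monomials[symmetric])
qed

lemma mderiv_mconst [simp]: "mderiv i (mconst c) = 0"
  by (simp add: mconst_def mderiv_single)

lemma mderiv_mvar: "mderiv i (mvar j) = (if i = j then 1 else 0)"
  by (auto simp: mvar_def mderiv_single lookup_single)

section \<open>Points hitting the derivative of a product of linear forms\<close>

definition lval :: "nat \<Rightarrow> (nat \<Rightarrow> complex) \<Rightarrow> (nat \<Rightarrow> complex) \<Rightarrow> complex" where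
  "lval n a x = (\<Sum>i<n. a i * x i)"

lemma lval_add: "lval n a (\<lambda>i. x i + c * y i) = lval n a x + c * lval n a y"
  by (simp add: lval_def ring_distribs sum.distrib sum_distrib_left mult_ac)

lemma lval_combine: "lval n (\<lambda>i. p * a i - q * b i) x = p * lval n a x - q * lval n b x"
  by (simp add: lval_def algebra_simps sum_subtractf sum_distrib_left)

lemma lval_scale: "(\<And>i. i < n \<Longrightarrow> a i = c * b i) \<Longrightarrow> lval n a x = c * lval n b x"
  by (simp add: lval_def sum_distrib_left mult_ac)

text \<open>On the moment curve the form \<open>a k\<close> becomes a polynomial in the parameter
  with the same coefficients, of degree at most \<open>n - 1\<close>. The bad parameters of all
  forms together number at most \<open>card I * (n - 1)\<close>, so one more parameter
  suffices.\<close>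

lemma moment_avoid:
  fixes a :: "'k \<Rightarrow> nat \<Rightarrow> complex"
  assumes "finite I" and nz: "\<And>k. k \<in> I \<Longrightarrow> \<exists>i<n. a k i \<noteq> 0"
  shows "\<exists>t\<in>{1..card I * (n - 1) + 1}. \<forall>k\<in>I. lval n (a k) (\<lambda>i. of_nat t ^ i) \<noteq> 0"
proof -
  define p where "p k = (\<Sum>i<n. monom (a k i) i)" for k
  define Z where "Z k = {t::nat. poly (p k) (of_nat t) = 0}" for k
  have pv: "poly (p k) z = lval n (a k) (\<lambda>i. z ^ i)" for k z
    by (simp add: p_def lval_def poly_sum poly_monom)
  have Z: "finite (Z k) \<and> card (Z k) \<le> n - 1" if k: "k \<in> I" for k
  proof -
    obtain i where i: "i < n" "a k i \<noteq> 0" using nz[OF k] by blast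
    have "coeff (p k) i = a k i"
      using i by (simp add: p_def coeff_sum sum.delta' if_distrib cong: if_cong)
    then have p0: "p k \<noteq> 0" using i by auto
    have deg: "degree (p k) \<le> n - 1"
      unfolding p_def by (rule degree_sum_le) (auto intro: order_trans[OF degree_monom_le])
    have "of_nat ` Z k \<subseteq> {z::complex. poly (p k) z = 0}" by (auto simp: Z_def)
    moreover have inj: "inj_on (of_nat :: nat \<Rightarrow> complex) (Z k)" by (simp add: inj_on_def)
    ultimately have "finite (Z k)" "card (Z k) \<le> card {z. poly (p k) z = 0}"
      using poly_roots_finite[OF p0] inj_on_finite[OF inj] card_inj_on_le[OF inj] by blast+
    moreover have "card {z. poly (p k) z = 0} \<le> degree (p k)"
      using card_poly_roots_bound[OF p0] by simp
    ultimately show ?thesis using deg by linarith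
  qed
  have "card (\<Union>k\<in>I. Z k) \<le> (\<Sum>k\<in>I. card (Z k))"
    by (rule card_UN_le[OF assms(1)])
  also have "\<dots> \<le> (\<Sum>k\<in>I. n - 1)" by (rule sum_mono) (use Z in blast)
  finally have c: "card (\<Union>k\<in>I. Z k) \<le> card I * (n - 1)" by simp
  have "\<not> {1..card I * (n - 1) + 1} \<subseteq> (\<Union>k\<in>I. Z k)"
  proof
    assume "{1..card I * (n - 1) + 1} \<subseteq> (\<Union>k\<in>I. Z k)"
    moreover have "finite (\<Union>k\<in>I. Z k)" using Z assms(1) by blast
    ultimately have "card {1..card I * (n - 1) + 1} \<le> card (\<Union>k\<in>I. Z k)" by (intro card_mono)
    then show False using c by simp
  qed
  then obtain t where "t \<in> {1..card I * (n - 1) + 1}" "t \<notin> (\<Union>k\<in>I. Z k)" by blast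
  then show ?thesis by (intro bexI[of _ t]) (auto simp: Z_def pv)
qed

text \<open>The Leibniz expansion for a product of the forms \<open>a k\<close>, the form
  \<open>b k\<close> standing for the derivative of \<open>a k\<close>.\<close>

definition prod_deriv :: "nat \<Rightarrow> nat \<Rightarrow> (nat \<Rightarrow> nat \<Rightarrow> complex) \<Rightarrow> (nat \<Rightarrow> nat \<Rightarrow> complex) \<Rightarrow> (nat \<Rightarrow> complex) \<Rightarrow> complex" where
  "prod_deriv n d a b x = (\<Sum>k<d. lval n (b k) x * (\<Prod>j\<in>{..<d}-{k}. lval n (a j) x))"

lemma prod_split:
  fixes f :: "'a \<Rightarrow> 'b :: comm_monoid_mult"
  assumes "finite A" "B \<subseteq> A"
  shows "prod f A = prod f B * prod f (A - B)"
  by (metis assms mult.commute prod.subset_diff)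

text \<open>The residue of \<open>\<Sum>\<^sub>k M\<^sub>k / p\<^sub>k\<close> at \<open>z\<close>: the terms in \<open>S\<close> all equal \<open>M\<^sub>i / p\<^sub>i\<close>, the others have no pole
  at \<open>z\<close>.\<close>

lemma residue_vanishes:
  fixes p M :: "nat \<Rightarrow> complex poly"
  assumes zero: "(\<Sum>k<d. M k * (\<Prod>j\<in>{..<d}-{k}. p j)) = 0"
    and nz: "\<And>k. k < d \<Longrightarrow> p k \<noteq> 0"
    and S: "S \<subseteq> {..<d}" "i \<in> S"
    and scaled: "\<And>k. k \<in> S \<Longrightarrow> p k = [:c k:] * p i \<and> M k = [:c k:] * M i"
    and root: "poly (p i) z = 0" and other: "\<And>k. k < d \<Longrightarrow> k \<notin> S \<Longrightarrow> poly (p k) z \<noteq> 0"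
  shows "poly (M i) z = 0"
proof -
  let ?R = "{..<d} - S" and ?P = "prod p S"
  have fin: "finite S" using S(1) finite_subset by blast
  \<comment> \<open>Cancelling \<open>?P\<close>, which is not 0, leaves an identity that can be
    evaluated at \<open>z\<close> although every factor in \<open>S\<close> vanishes there.\<close>
  have P0: "?P \<noteq> 0" using nz S(1) by (subst prod_zero_iff[OF fin]) auto
  define R where "R = (\<Sum>k\<in>?R. M k * (\<Prod>j\<in>?R-{k}. p j))"
  \<comment> \<open>Proportionality gives \<open>p i * M k = p k * M i\<close>, and
    \<open>p k\<close> completes the product of all factors.\<close>
  have 1: "p i * (M k * (\<Prod>j\<in>{..<d}-{k}. p j)) = ?P * (M i * prod p ?R)" if k: "k \<in> S" for k
  proof -
    have "prod p {..<d} = p k * (\<Prod>j\<in>{..<d}-{k}. p j)"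
      using k S(1) by (auto intro!: prod.remove)
    moreover have "p i * M k = p k * M i" using scaled[OF k] by simp
    moreover have "prod p {..<d} = ?P * prod p ?R" using S(1) by (intro prod_split) auto
    ultimately show ?thesis by (metis (no_types, lifting) mult.assoc mult.left_commute)
  qed
  \<comment> \<open>For \<open>k\<close> outside \<open>S\<close> the omitted factor is not part of
    \<open>?P\<close>, and \<open>p i\<close> stays as a factor that vanishes at
    \<open>z\<close>.\<close>
  have 2: "p i * (M k * (\<Prod>j\<in>{..<d}-{k}. p j)) = ?P * (p i * (M k * (\<Prod>j\<in>?R-{k}. p j)))"
    if k: "k \<in> ?R" for k
  proof -
    have "{..<d} - {k} - S = ?R - {k}" by auto
    then have "(\<Prod>j\<in>{..<d}-{k}. p j) = ?P * (\<Prod>j\<in>?R-{k}. p j)"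
      using prod_split[of "{..<d}-{k}" S p] S(1) k by auto
    then show ?thesis by (simp add: mult_ac)
  qed
  have "0 = p i * (\<Sum>k<d. M k * (\<Prod>j\<in>{..<d}-{k}. p j))" by (simp add: zero)
  also have "\<dots> = (\<Sum>k<d. p i * (M k * (\<Prod>j\<in>{..<d}-{k}. p j)))" by (rule sum_distrib_left)
  also have "\<dots> = (\<Sum>k\<in>S. p i * (M k * (\<Prod>j\<in>{..<d}-{k}. p j))) +
      (\<Sum>k\<in>?R. p i * (M k * (\<Prod>j\<in>{..<d}-{k}. p j)))"
    by (subst sum.subset_diff[OF S(1)]) (auto simp: add.commute)
  also have "\<dots> = ?P * (of_nat (card S) * (M i * prod p ?R) + p i * R)"
  proof -
    have "(\<Sum>k\<in>S. p i * (M k * (\<Prod>j\<in>{..<d}-{k}. p j))) = (\<Sum>k\<in>S. ?P * (M i * prod p ?R))"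
      by (rule sum.cong[OF refl]) (rule 1)
    moreover have "(\<Sum>k\<in>?R. p i * (M k * (\<Prod>j\<in>{..<d}-{k}. p j))) = ?P * (p i * R)"
      unfolding R_def sum_distrib_left by (rule sum.cong[OF refl]) (rule 2)
    ultimately show ?thesis by (simp add: algebra_simps)
  qed
  finally have "of_nat (card S) * (M i * prod p ?R) + p i * R = 0" using P0 by auto
  from arg_cong[OF this, of "\<lambda>q. poly q z"]
  have "of_nat (card S) * (poly (M i) z * poly (prod p ?R) z) = 0" using root by simp
  moreover have "poly (prod p ?R) z \<noteq> 0" using other by (auto simp: poly_prod)
  \<comment> \<open>In characteristic 0 the number of terms in \<open>S\<close> is an invertible
    factor.\<close>
  moreover have "card S \<noteq> 0" using S(2) fin by auto
  ultimately show ?thesis by simp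
qed

text \<open>All \<open>b k\<close> arise from one matrix \<open>C\<close>, so proportional forms
  have images proportional with the same factor. This is what \<open>residue_vanishes\<close> needs
  when several factors share a root on the line.\<close>

lemma hitting_set:
  fixes a b :: "nat \<Rightarrow> nat \<Rightarrow> complex"
  assumes nz: "\<And>k. k < d \<Longrightarrow> \<exists>i<n. a k i \<noteq> 0"
    and b: "\<And>k j. k < d \<Longrightarrow> j < n \<Longrightarrow> b k j = (\<Sum>i<n. a k i * C i j)"
    and Gv: "\<And>t. t \<in> {1..d * (n - 1) + 1} \<Longrightarrow> prod_deriv n d a b (\<lambda>i. of_nat t ^ i) = 0"
    and Guv: "\<And>s t l. s \<in> {1..d\<^sup>2 * (n - 1) + 1} \<Longrightarrow> t \<in> {1..d * (n - 1) + 1} \<Longrightarrow> l \<in> {1..2 * d + 1} \<Longrightarrow>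
      prod_deriv n d a b (\<lambda>i. of_nat s ^ i + of_nat l * of_nat t ^ i) = 0"
  obtains \<mu> where "\<And>k j. k < d \<Longrightarrow> j < n \<Longrightarrow> b k j = \<mu> k * a k j" "(\<Sum>k<d. \<mu> k) = 0"
proof -
  obtain t where t: "t \<in> {1..d * (n - 1) + 1}"
    and av: "\<forall>k\<in>{..<d}. lval n (a k) (\<lambda>i. of_nat t ^ i) \<noteq> 0"
    using moment_avoid[of "{..<d}" n a] nz by auto
  define v :: "nat \<Rightarrow> complex" where "v = (\<lambda>i. of_nat t ^ i)"
  have av: "lval n (a k) v \<noteq> 0" if "k < d" for k using av that by (auto simp: v_def)
  \<comment> \<open>On the line \<open>u + \<lambda> v\<close> the roots of the forms \<open>i \<noteq> k\<close> differ unless \<open>F (i, k)\<close> vanishes at \<open>u\<close>, and the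
    diagonal form \<open>F (i, i)\<close> vanishes at \<open>u\<close> if \<open>b\<^sub>i\<close> shares the root of \<open>a\<^sub>i\<close>.\<close>
  define F where "F = (\<lambda>(i, k). if i = k then (\<lambda>j. lval n (a i) v * b i j - lval n (b i) v * a i j)
     else (\<lambda>j. lval n (a k) v * a i j - lval n (a i) v * a k j))"
  define I where "I = {q \<in> {..<d} \<times> {..<d}. \<exists>j<n. F q j \<noteq> 0}"
  have finI: "finite I" by (simp add: I_def)
  \<comment> \<open>One form per ordered pair, the diagonal included: this is the source of
    \<open>d\<^sup>2\<close> in the range of \<open>s\<close>.\<close>
  have cI: "card I \<le> d\<^sup>2"
    using card_mono[of "{..<d} \<times> {..<d}" I] by (auto simp: I_def card_cartesian_product power2_eq_square)
  obtain s where s: "s \<in> {1..card I * (n - 1) + 1}"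
    and Fs: "\<forall>q\<in>I. lval n (F q) (\<lambda>i. of_nat s ^ i) \<noteq> 0"
    using moment_avoid[OF finI, of n F] by (auto simp: I_def)
  have s': "s \<in> {1..d\<^sup>2 * (n - 1) + 1}"
    using s mult_le_mono1[OF cI, of "n - 1"] unfolding atLeastAtMost_iff by linarith
  define u :: "nat \<Rightarrow> complex" where "u = (\<lambda>i. of_nat s ^ i)"
  have Fu: "F (i, k) j = 0" if "i < d" "k < d" "j < n" "lval n (F (i, k)) u = 0" for i k j
    using Fs that by (force simp: I_def u_def)
  \<comment> \<open>Restrictions to the line \<open>u + z v\<close>; by the choice of
    \<open>v\<close>, each \<open>p k\<close> with \<open>k < d\<close> has degree exactly
    1.\<close>
  define p where "p k = [:lval n (a k) u, lval n (a k) v:]" for k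
  define M where "M k = [:lval n (b k) u, lval n (b k) v:]" for k
  define D where "D = (\<Sum>k<d. M k * (\<Prod>j\<in>{..<d}-{k}. p j))"
  have pD: "poly D z = prod_deriv n d a b (\<lambda>i. u i + z * v i)" for z
  proof -
    have "poly (p k) z = lval n (a k) (\<lambda>i. u i + z * v i)"
      "poly (M k) z = lval n (b k) (\<lambda>i. u i + z * v i)" for k
      by (simp_all add: p_def M_def lval_add)
    then show ?thesis by (simp add: D_def poly_sum poly_prod prod_deriv_def)
  qed
  have D0: "D = 0"
  proof (rule ccontr)
    assume D: "D \<noteq> 0"
    \<comment> \<open>Each summand multiplies \<open>d\<close> polynomials of degree at most 1,
      while the line carries \<open>2 * d + 1\<close> zeros.\<close>
    have "degree D \<le> d"
      unfolding D_def
    proof (rule degree_sum_le)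
      fix k assume k: "k \<in> {..<d}"
      have "degree (\<Prod>j\<in>{..<d}-{k}. p j) \<le> (\<Sum>j\<in>{..<d}-{k}. degree (p j))"
        using degree_prod_sum_le[of "{..<d}-{k}" p] by (simp add: comp_def)
      also have "\<dots> \<le> (\<Sum>j\<in>{..<d}-{k}. 1)" by (rule sum_mono) (simp add: p_def)
      finally have "degree (\<Prod>j\<in>{..<d}-{k}. p j) \<le> d - 1" using k by simp
      moreover have "degree (M k) \<le> 1" by (simp add: M_def)
      ultimately show "degree (M k * (\<Prod>j\<in>{..<d}-{k}. p j)) \<le> d"
        using degree_mult_le[of "M k" "\<Prod>j\<in>{..<d}-{k}. p j"] k by auto
    qed simp
    moreover have "card {z. poly D z = 0} \<le> degree D" using card_poly_roots_bound[OF D] .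
    moreover have "of_nat ` {1..2 * d + 1} \<subseteq> {z. poly D z = 0}"
      using Guv[OF s' t] by (auto simp: pD u_def v_def)
    then have "card (of_nat ` {1..2 * d + 1} :: complex set) \<le> card {z. poly D z = 0}"
      by (intro card_mono poly_roots_finite[OF D])
    moreover have "card (of_nat ` {1..2 * d + 1} :: complex set) = 2 * d + 1"
      by (subst card_image) (auto simp: inj_on_def)
    ultimately show False by linarith
  qed
  define \<mu> where "\<mu> i = lval n (b i) v / lval n (a i) v" for i
  have \<mu>: "b i j = \<mu> i * a i j" if i: "i < d" and j: "j < n" for i j
  proof -
    \<comment> \<open>The indices of the forms proportional to \<open>a i\<close>. Their values at
      \<open>v\<close> are nonzero and give the only possible ratio.\<close>
    define S where "S = {k. k < d \<and> (\<forall>j<n. lval n (a k) v * a i j = lval n (a i) v * a k j)}"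
    define c where "c k = lval n (a k) v / lval n (a i) v" for k
    \<comment> \<open>The only root of \<open>p i\<close>.\<close>
    define z where "z = - lval n (a i) u / lval n (a i) v"
    have ck: "a k j = c k * a i j" if "k \<in> S" "j < n" for k j
      using that av[OF i] by (auto simp: S_def c_def field_simps)
    have bk: "b k j = c k * b i j" if "k \<in> S" "j < n" for k j
    proof -
      have "k < d" using that by (simp add: S_def)
      then have "b k j = (\<Sum>l<n. a k l * C l j)" using that b by blast
      also have "\<dots> = (\<Sum>l<n. c k * (a i l * C l j))" using ck[OF that(1)] by (simp add: mult.assoc)
      also have "\<dots> = c k * b i j" using b[OF i that(2)] by (simp add: sum_distrib_left)
      finally show ?thesis .
    qed
    have "poly (M i) z = 0"
    proof (rule residue_vanishes[where p = p and S = S and c = c])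
      show "(\<Sum>k<d. M k * (\<Prod>j\<in>{..<d}-{k}. p j)) = 0" using D0 D_def by simp
      show "p k \<noteq> 0" if "k < d" for k using av[OF that] by (simp add: p_def)
      show "S \<subseteq> {..<d}" "i \<in> S" using i by (auto simp: S_def)
      show "p k = [:c k:] * p i \<and> M k = [:c k:] * M i" if "k \<in> S" for k
        using lval_scale[of n "a k" "c k" "a i"] lval_scale[of n "b k" "c k" "b i"] ck[OF that] bk[OF that]
        by (simp add: p_def M_def)
      show "poly (p i) z = 0" using av[OF i] by (simp add: p_def z_def)
      show "poly (p k) z \<noteq> 0" if k: "k < d" "k \<notin> S" for k
      proof
        \<comment> \<open>Up to sign, the value of \<open>F (i, k)\<close> at \<open>u\<close> is
          the resultant of \<open>p i\<close> and \<open>p k\<close>, so a common root makes it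
          vanish.\<close>
        assume "poly (p k) z = 0"
        then have "lval n (a k) u * lval n (a i) v = lval n (a i) u * lval n (a k) v"
          using av[OF i] by (simp add: p_def z_def field_simps)
        moreover have "k \<noteq> i" using k by (auto simp: S_def)
        ultimately have "lval n (F (i, k)) u = 0"
          by (simp add: F_def lval_combine) (simp add: mult.commute)
        then have "\<forall>j<n. F (i, k) j = 0" using Fu i k by blast
        then have "k \<in> S" using k(1) \<open>k \<noteq> i\<close> by (auto simp: S_def F_def)
        then show False using k by simp
      qed
    qed
    \<comment> \<open>The same for \<open>M i\<close> and \<open>p i\<close>, which share the root
      \<open>z\<close>.\<close>
    then have "lval n (F (i, i)) u = 0"
      unfolding F_def using av[OF i] by (simp add: M_def z_def lval_combine divide_simps) (simp add: algebra_simps)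
    from Fu[OF i i j this] show ?thesis
      using av[OF i] by (simp add: F_def \<mu>_def field_simps)
  qed
  \<comment> \<open>No form vanishes at \<open>v\<close>, so the value there determines the sum of
    the \<open>\<mu> k\<close>.\<close>
  have "0 = prod_deriv n d a b v" using Gv[OF t] by (simp add: v_def)
  also have "\<dots> = (\<Sum>k<d. \<mu> k * (\<Prod>j<d. lval n (a j) v))"
    unfolding prod_deriv_def
  proof (rule sum.cong[OF refl])
    fix k assume k: "k \<in> {..<d}"
    have "lval n (b k) v = \<mu> k * lval n (a k) v"
      using \<mu> k by (intro lval_scale) auto
    moreover have "(\<Prod>j<d. lval n (a j) v) = lval n (a k) v * (\<Prod>j\<in>{..<d}-{k}. lval n (a j) v)"
      using k by (intro prod.remove) auto
    ultimately show "lval n (b k) v * (\<Prod>j\<in>{..<d}-{k}. lval n (a j) v) =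
        \<mu> k * (\<Prod>j<d. lval n (a j) v)" by simp
  qed
  finally have "(\<Sum>k<d. \<mu> k) * (\<Prod>j<d. lval n (a j) v) = 0" by (simp add: sum_distrib_right)
  then have "(\<Sum>k<d. \<mu> k) = 0" using av by simp
  with \<mu> show thesis using that by blast
qed

section \<open>The Lie algebra of a product of linear forms\<close>

definition lform :: "nat \<Rightarrow> (nat \<Rightarrow> complex) \<Rightarrow> mpoly" where
  "lform n a = (\<Sum>i<n. mconst (a i) * mvar i)"

lemma meval_lform [simp]: "meval (lform n a) x = lval n a x"
  by (simp add: lform_def lval_def meval_sum meval_mult)

lemma mconst_simps:
  "mconst 0 = 0" "mconst 1 = 1" "mconst (a + b) = mconst a + mconst b" "mconst (a * b) = mconst a * mconst b"
  by (simp_all add: mconst_def single_add mult_single)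

lemma mconst_sum: "mconst (sum f A) = (\<Sum>a\<in>A. mconst (f a))"
  by (induction A rule: infinite_finite_induct) (auto simp: mconst_simps)

lemma lform_scale: "(\<And>i. i < n \<Longrightarrow> a i = c * b i) \<Longrightarrow> lform n a = mconst c * lform n b"
  by (simp add: lform_def sum_distrib_left mconst_simps mult_ac)

text \<open>The derivation along the linear vector field x \<mapsto> C x; on a product it is
  governed by its effect on the factors.\<close>

definition lie_deriv :: "nat \<Rightarrow> complex mat \<Rightarrow> mpoly \<Rightarrow> mpoly" where
  "lie_deriv n C P = (\<Sum>i<n. \<Sum>j<n. mconst (C $$ (i, j)) * mvar j * mderiv i P)"

lemma meval_lie_deriv:
  "meval (lie_deriv n C P) x = (\<Sum>i<n. \<Sum>j<n. C $$ (i, j) * x j * meval (mderiv i P) x)"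
  by (simp add: lie_deriv_def meval_sum meval_mult)

lemma lie_deriv_mult: "lie_deriv n C (P * Q) = lie_deriv n C P * Q + P * lie_deriv n C Q"
  by (simp add: lie_deriv_def mderiv_mult ring_distribs sum.distrib sum_distrib_left sum_distrib_right mult_ac)

lemma lie_deriv_one: "lie_deriv n C 1 = 0"
  using mderiv_mconst[of _ 1] by (simp add: lie_deriv_def mconst_simps)

lemma lie_deriv_prod:
  "finite A \<Longrightarrow> lie_deriv n C (prod f A) = (\<Sum>k\<in>A. lie_deriv n C (f k) * (\<Prod>j\<in>A-{k}. f j))"
proof (induction A rule: finite_induct)
  case empty
  show ?case by (simp add: lie_deriv_one)
next
  case (insert x A)
  have "(\<Prod>j\<in>insert x A-{k}. f j) = f x * (\<Prod>j\<in>A-{k}. f j)" if "k \<in> A" for k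
  proof -
    have "insert x A - {k} = insert x (A - {k})" using that insert.hyps by auto
    then show ?thesis using insert.hyps by simp
  qed
  then have "(\<Sum>k\<in>A. lie_deriv n C (f k) * (\<Prod>j\<in>insert x A-{k}. f j)) =
      f x * (\<Sum>k\<in>A. lie_deriv n C (f k) * (\<Prod>j\<in>A-{k}. f j))"
    by (simp add: sum_distrib_left mult_ac)
  moreover have "insert x A - {x} = A" using insert.hyps by auto
  ultimately show ?case using insert by (simp add: lie_deriv_mult)
qed

lemma mderiv_lform: "i < n \<Longrightarrow> mderiv i (lform n a) = mconst (a i)"
proof -
  assume i: "i < n"
  have "mderiv i (lform n a) = (\<Sum>j<n. if i = j then mconst (a j) else 0)"
    unfolding lform_def mderiv_sum by (intro sum.cong refl) (simp add: mderiv_mult mderiv_mvar)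
  also have "\<dots> = mconst (a i)" using i by (simp add: sum.delta)
  finally show ?thesis .
qed

text \<open>Row vector times matrix: the coefficients of x \<mapsto> l(C x) when \<open>a\<close>
  lists those of l.\<close>

abbreviation act :: "nat \<Rightarrow> complex mat \<Rightarrow> (nat \<Rightarrow> complex) \<Rightarrow> nat \<Rightarrow> complex" where
  "act n C a \<equiv> (\<lambda>j. \<Sum>i<n. a i * C $$ (i, j))"

lemma lie_deriv_lform: "lie_deriv n C (lform n a) = lform n (act n C a)"
proof -
  have "lie_deriv n C (lform n a) = (\<Sum>i<n. \<Sum>j<n. mconst (C $$ (i, j)) * mvar j * mconst (a i))"
    unfolding lie_deriv_def by (intro sum.cong refl) (simp add: mderiv_lform)
  also have "\<dots> = (\<Sum>j<n. \<Sum>i<n. mconst (C $$ (i, j)) * mvar j * mconst (a i))"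
    by (rule sum.swap)
  also have "\<dots> = lform n (act n C a)"
    unfolding lform_def mconst_sum by (simp add: sum_distrib_left sum_distrib_right mconst_simps mult_ac)
  finally show ?thesis .
qed

lemma meval_lie_deriv_product:
  "meval (lie_deriv n C (\<Prod>k<d. lform n (a k))) x = prod_deriv n d a (\<lambda>k. act n C (a k)) x"
  by (simp add: lie_deriv_prod lie_deriv_lform meval_sum meval_mult meval_prod prod_deriv_def)

section \<open>Homogeneity and the number of factors\<close>

abbreviation mdeg :: "(nat \<Rightarrow>\<^sub>0 nat) \<Rightarrow> nat" where
  "mdeg m \<equiv> (\<Sum>i \<in> Poly_Mapping.keys m. Poly_Mapping.lookup m i)"

lemma mdeg_add: "mdeg (m + m') = mdeg m + mdeg m'"
  by (rule setsum_keys_plus_distrib) auto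

text \<open>The zero polynomial is homogeneous of every degree here, so a degree is read off only
  after it has been excluded.\<close>

definition homogeneous :: "nat \<Rightarrow> mpoly \<Rightarrow> bool" where
  "homogeneous k P \<longleftrightarrow> (\<forall>m\<in>Poly_Mapping.keys P. mdeg m = k)"

lemma homogeneous_mult: "homogeneous k P \<Longrightarrow> homogeneous l Q \<Longrightarrow> homogeneous (k + l) (P * Q)"
  using keys_mult[of P Q] by (fastforce simp: homogeneous_def mdeg_add)

lemma homogeneous_add: "homogeneous k P \<Longrightarrow> homogeneous k Q \<Longrightarrow> homogeneous k (P + Q)"
  using keys_add[of P Q] by (fastforce simp: homogeneous_def)

lemma homogeneous_lform: "homogeneous 1 (lform n a)"
proof -
  have 1: "homogeneous 1 (mconst (a i) * mvar i)" for i
    by (simp add: mconst_def mvar_def mult_single homogeneous_def)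
  show ?thesis unfolding lform_def
    by (induction n) (use 1 in \<open>auto intro!: homogeneous_add simp: homogeneous_def[of _ 0]\<close>)
qed

lemma homogeneous_prod_list: "(\<And>l. l \<in> set ls \<Longrightarrow> homogeneous 1 l) \<Longrightarrow> homogeneous (length ls) (prod_list ls)"
proof (induction ls)
  case Nil
  show ?case by (simp add: homogeneous_def)
next
  case (Cons l ls)
  then show ?case using homogeneous_mult[of 1 l "length ls" "prod_list ls"] by simp
qed

lemma homogeneous_degree:
  "homogeneous k P \<Longrightarrow> P \<noteq> 0 \<Longrightarrow> total_degree P = k"
proof -
  assume h: "homogeneous k P" and "P \<noteq> 0"
  then obtain m where "m \<in> Poly_Mapping.keys P" by (metis all_not_in_conv keys_eq_empty)
  then have "mdeg ` Poly_Mapping.keys P = {k}" using h by (auto simp: homogeneous_def)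
  then show ?thesis unfolding total_degree_def by simp
qed

text \<open>A product of linear forms is homogeneous of degree the number of factors, which ties the
  length of the list to \<open>total_degree P\<close>. As \<open>P\<close> is not 0, no factor is
  0.\<close>

lemma product_of_linear_forms_factors:
  assumes "product_of_linear_forms n P" "total_degree P \<ge> 1"
  obtains a where "P = (\<Prod>k<total_degree P. lform n (a k))" "\<And>k. k < total_degree P \<Longrightarrow> \<exists>i<n. a k i \<noteq> 0"
proof -
  obtain ls where ls: "\<And>l. l \<in> set ls \<Longrightarrow> linear_form n l" and P: "P = prod_list ls"
    using assms(1) by (auto simp: product_of_linear_forms_def)
  \<comment> \<open>The zero polynomial has \<open>total_degree\<close> 0 by convention.\<close>
  have P0: "P \<noteq> 0" using assms(2) by (auto simp: total_degree_def)
  have hom: "homogeneous 1 l" if "l \<in> set ls" for l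
    using ls[OF that] homogeneous_lform[of n] by (auto simp: linear_form_def lform_def)
  have len: "total_degree P = length ls"
    using homogeneous_degree[OF homogeneous_prod_list[OF hom]] P P0 by blast
  have "\<forall>k. \<exists>a. k < length ls \<longrightarrow> ls ! k = lform n a"
    using ls by (metis linear_form_def lform_def nth_mem)
  then obtain a where a: "\<And>k. k < length ls \<Longrightarrow> ls ! k = lform n (a k)" by metis
  have "P = (\<Prod>k<length ls. lform n (a k))"
    using a by (simp add: P prod.list_conv_set_nth atLeast0LessThan)
  moreover have "\<exists>i<n. a k i \<noteq> 0" if k: "k < length ls" for k
  proof (rule ccontr)
    assume "\<not> ?thesis"
    then have "lform n (a k) = 0" by (simp add: lform_def mconst_simps)
    then have "0 \<in> set ls" using a[OF k] k by (metis nth_mem)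
    then have "P = 0" using P by (induction ls arbitrary: P) auto
    then show False using P0 by simp
  qed
  ultimately show thesis using that len by simp
qed

text \<open>By \<open>hitting_set\<close> every factor is an eigenvector of the derivation, and the
  eigenvalue of \<open>P\<close> is the sum of the \<open>\<mu> k\<close>, which is 0. Points are
  functions here, so that both \<open>Lambda_points\<close> and the grid of the algorithm
  fit.\<close>

lemma mem_lie_algebra:
  assumes P: "P = (\<Prod>k<d. lform n (a k))" and nz: "\<And>k. k < d \<Longrightarrow> \<exists>i<n. a k i \<noteq> 0"
    and C: "C \<in> carrier_mat n n"
    and Gv: "\<And>t. t \<in> {1..d * (n - 1) + 1} \<Longrightarrow> meval (lie_deriv n C P) (\<lambda>i. of_nat t ^ i) = 0"
    and Guv: "\<And>s t l. s \<in> {1..d\<^sup>2 * (n - 1) + 1} \<Longrightarrow> t \<in> {1..d * (n - 1) + 1} \<Longrightarrow> l \<in> {1..2 * d + 1} \<Longrightarrow>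
      meval (lie_deriv n C P) (\<lambda>i. of_nat s ^ i + of_nat l * of_nat t ^ i) = 0"
  shows "C \<in> lie_algebra n P"
proof -
  obtain \<mu> where \<mu>: "\<And>k j. k < d \<Longrightarrow> j < n \<Longrightarrow> act n C (a k) j = \<mu> k * a k j" "(\<Sum>k<d. \<mu> k) = 0"
    by (rule hitting_set[where b = "\<lambda>k. act n C (a k)" and C = "\<lambda>i j. C $$ (i, j)", OF nz])
      (use Gv Guv in \<open>auto simp: P meval_lie_deriv_product\<close>)
  have "lie_deriv n C P = (\<Sum>k<d. mconst (\<mu> k) * P)"
    unfolding P lie_deriv_prod[OF finite_lessThan]
  proof (rule sum.cong[OF refl])
    fix k assume k: "k \<in> {..<d}"
    have "(\<Prod>j<d. lform n (a j)) = lform n (a k) * (\<Prod>j\<in>{..<d}-{k}. lform n (a j))"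
      using k by (intro prod.remove) auto
    moreover have "lie_deriv n C (lform n (a k)) = mconst (\<mu> k) * lform n (a k)"
      unfolding lie_deriv_lform using \<mu> k by (intro lform_scale) auto
    ultimately show "lie_deriv n C (lform n (a k)) * (\<Prod>j\<in>{..<d}-{k}. lform n (a j)) =
        mconst (\<mu> k) * (\<Prod>j<d. lform n (a j))" by (simp add: mult.assoc)
  qed
  also have "\<dots> = 0" by (simp only: \<mu>(2) mconst_simps mult_zero_left sum_distrib_right[symmetric] mconst_sum[symmetric])
  finally show ?thesis using C by (simp add: lie_algebra_def lie_deriv_def)
qed

text \<open>Vector entries from index \<open>n\<close> on are unspecified, so a vector and a
  function describing the same point agree only below \<open>n\<close>.\<close>

lemma prod_deriv_cong:
  assumes "\<And>i. i < n \<Longrightarrow> x i = y i"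
  shows "prod_deriv n d a b x = prod_deriv n d a b y"
  using assms by (simp add: prod_deriv_def lval_def)

lemma moment_pointsI: "t \<in> {1..k * (n - 1) + 1} \<Longrightarrow> vec n (\<lambda>i. of_nat t ^ i) \<in> moment_points n k"
  by (simp add: moment_points_def)

lemma Lambda_pointsI:
  "v \<in> moment_points n m \<Longrightarrow> u \<in> moment_points n (m\<^sup>2) \<union> {0\<^sub>v n} \<Longrightarrow> l \<in> {1..2 * m + 1} \<Longrightarrow>
    u + of_nat l \<cdot>\<^sub>v v \<in> Lambda_points m n"
  unfolding Lambda_points_def by blast

lemma mem_lie_algebra_iff_Lambda:
  assumes "product_of_linear_forms n P" "total_degree P = d" "d \<ge> 1" and C: "C \<in> carrier_mat n n"
  shows "C \<in> lie_algebra n P \<longleftrightarrow>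
          (\<forall>x \<in> Lambda_points d n.
             (\<Sum>i<n. \<Sum>j<n. C $$ (i, j) * x $ j * meval (mderiv i P) (\<lambda>k. x $ k)) = 0)"
proof
  assume "C \<in> lie_algebra n P"
  then have "lie_deriv n C P = 0" by (simp add: lie_algebra_def lie_deriv_def)
  then have "meval (lie_deriv n C P) (\<lambda>k. x $ k) = 0" for x by simp
  then show "\<forall>x \<in> Lambda_points d n.
      (\<Sum>i<n. \<Sum>j<n. C $$ (i, j) * x $ j * meval (mderiv i P) (\<lambda>k. x $ k)) = 0"
    by (simp add: meval_lie_deriv)
next
  assume *: "\<forall>x \<in> Lambda_points d n.
      (\<Sum>i<n. \<Sum>j<n. C $$ (i, j) * x $ j * meval (mderiv i P) (\<lambda>k. x $ k)) = 0"
  obtain a where P: "P = (\<Prod>k<d. lform n (a k))" and nz: "\<And>k. k < d \<Longrightarrow> \<exists>i<n. a k i \<noteq> 0"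
    using product_of_linear_forms_factors[of n P] assms by metis
  have ev: "meval (lie_deriv n C P) y = 0" if "x \<in> Lambda_points d n" "\<And>i. i < n \<Longrightarrow> x $ i = y i" for x y
  proof -
    have "meval (lie_deriv n C P) (\<lambda>k. x $ k) = 0" using * that(1) by (simp add: meval_lie_deriv)
    moreover have "prod_deriv n d a b (\<lambda>k. x $ k) = prod_deriv n d a b y" for b
      by (rule prod_deriv_cong) (rule that(2))
    ultimately show ?thesis unfolding P meval_lie_deriv_product by simp
  qed
  show "C \<in> lie_algebra n P"
  proof (rule mem_lie_algebra[OF P nz C])
    fix t assume t: "t \<in> {1..d * (n - 1) + 1}"
    \<comment> \<open>\<open>u = 0\<close> and \<open>l = 1\<close> give the point of the moment
      curve itself.\<close>
    let ?x = "0\<^sub>v n + of_nat 1 \<cdot>\<^sub>v vec n (\<lambda>i. of_nat t ^ i) :: complex vec"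
    have "?x \<in> Lambda_points d n"
      using t by (intro Lambda_pointsI moment_pointsI) auto
    then show "meval (lie_deriv n C P) (\<lambda>i. of_nat t ^ i) = 0"
      by (rule ev) simp
  next
    fix s t l assume st: "s \<in> {1..d\<^sup>2 * (n - 1) + 1}" "t \<in> {1..d * (n - 1) + 1}" "l \<in> {1..2 * d + 1}"
    let ?x = "vec n (\<lambda>i. of_nat s ^ i) + of_nat l \<cdot>\<^sub>v vec n (\<lambda>i. of_nat t ^ i) :: complex vec"
    have "?x \<in> Lambda_points d n"
      using st by (intro Lambda_pointsI UnI1 moment_pointsI) auto
    then show "meval (lie_deriv n C P) (\<lambda>i. of_nat s ^ i + of_nat l * of_nat t ^ i) = 0"
      by (rule ev) simp
  qed simp
qed

section \<open>Bases of spaces of solutions\<close>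

text \<open>The basis vectors are indexed by an arbitrary set, because elimination drops the pivot
  from the middle of the list.\<close>

definition null_basis :: "nat \<Rightarrow> (nat \<Rightarrow> complex) set \<Rightarrow> 'k set \<Rightarrow> ('k \<Rightarrow> nat \<Rightarrow> complex) \<Rightarrow> bool" where
  "null_basis m \<Phi> I B \<longleftrightarrow>
     (\<forall>q\<in>I. \<forall>\<phi>\<in>\<Phi>. lval m \<phi> (B q) = 0) \<and>
     (\<forall>w. (\<forall>\<phi>\<in>\<Phi>. lval m \<phi> w = 0) \<longrightarrow> (\<exists>c. \<forall>e<m. w e = (\<Sum>q\<in>I. c q * B q e))) \<and>
     (\<forall>c. (\<forall>e<m. (\<Sum>q\<in>I. c q * B q e) = 0) \<longrightarrow> (\<forall>q\<in>I. c q = 0))"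

lemma null_basis_indep:
  assumes "null_basis m \<Phi> I B" "\<forall>e<m. (\<Sum>q\<in>I. c q * B q e) = 0"
  shows "\<forall>q\<in>I. c q = 0"
  using assms(1)[unfolded null_basis_def, THEN conjunct2, THEN conjunct2, THEN spec, of c] assms(2)
  by (rule mp)

lemma null_basis_span:
  assumes "null_basis m \<Phi> I B" "\<forall>\<phi>\<in>\<Phi>. lval m \<phi> w = 0"
  obtains c where "\<And>e. e < m \<Longrightarrow> w e = (\<Sum>q\<in>I. c q * B q e)"
  using assms unfolding null_basis_def by blast

lemma null_basis_zero: "null_basis m \<Phi> I B \<Longrightarrow> q \<in> I \<Longrightarrow> \<phi> \<in> \<Phi> \<Longrightarrow> lval m \<phi> (B q) = 0"
  unfolding null_basis_def by blast

lemma lval_sum: "lval m \<phi> (\<lambda>e. \<Sum>q\<in>I. c q * B q e) = (\<Sum>q\<in>I. c q * lval m \<phi> (B q))"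
  unfolding lval_def sum_distrib_left by (subst sum.swap) (simp add: mult_ac)

lemma lval_cong: "(\<And>e. e < m \<Longrightarrow> v e = w e) \<Longrightarrow> lval m \<phi> v = lval m \<phi> w"
  by (simp add: lval_def)

lemma null_basis_cong:
  assumes "\<And>q e. q \<in> I \<Longrightarrow> e < m \<Longrightarrow> B q e = B' q e" "null_basis m \<Phi> I B"
  shows "null_basis m \<Phi> I B'"
proof -
  have "lval m \<phi> (B' q) = lval m \<phi> (B q)" if "q \<in> I" for \<phi> q
    by (rule lval_cong) (simp add: assms(1)[OF that])
  moreover have "(\<Sum>q\<in>I. c q * B' q e) = (\<Sum>q\<in>I. c q * B q e)" if "e < m" for c e
    using assms(1)[OF _ that] by simp
  ultimately show ?thesis using assms(2) unfolding null_basis_def by simp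
qed

lemma null_basis_unit: "null_basis m {} {..<m} (\<lambda>q e. if q = e then 1 else 0)"
  unfolding null_basis_def by (simp add: sum.delta if_distrib cong: if_cong) blast

lemma null_basis_insert_zero:
  assumes "null_basis m \<Phi> I B" "\<And>q. q \<in> I \<Longrightarrow> lval m \<phi> (B q) = 0"
  shows "null_basis m (insert \<phi> \<Phi>) I B"
  using assms by (simp add: null_basis_def)

text \<open>Gaussian elimination by one equation: subtracting a multiple of the pivot vector makes
  \<open>\<phi>\<close> vanish on every other basis vector.\<close>

lemma null_basis_pivot:
  assumes nb: "null_basis m \<Phi> I B" and p: "finite I" "p \<in> I" "lval m \<phi> (B p) \<noteq> 0"
  shows "null_basis m (insert \<phi> \<Phi>) (I - {p})
    (\<lambda>q e. B q e - lval m \<phi> (B q) / lval m \<phi> (B p) * B p e)" (is "null_basis _ _ ?J ?E")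
proof -
  define t where "t q = lval m \<phi> (B q) / lval m \<phi> (B p)" for q
  \<comment> \<open>Combinations of the new vectors are combinations of the old ones with a
    prescribed pivot coefficient, so span and independence carry over.\<close>
  have E: "(\<Sum>q\<in>?J. c q * ?E q e) = (\<Sum>q\<in>I. (c(p := - (\<Sum>q\<in>?J. c q * t q))) q * B q e)" for c e
  proof -
    have "(\<Sum>q\<in>?J. c q * ?E q e) = (\<Sum>q\<in>?J. c q * B q e) - (\<Sum>q\<in>?J. c q * t q) * B p e"
      by (simp add: t_def algebra_simps sum_subtractf sum_distrib_left)
    then show ?thesis using p by (simp add: sum.remove[of I p])
  qed
  have z: "lval m \<psi> (?E q) = 0" if "q \<in> ?J" "\<psi> \<in> insert \<phi> \<Phi>" for q \<psi>
  proof -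
    have "lval m \<psi> (?E q) = lval m \<psi> (B q) - t q * lval m \<psi> (B p)"
      using lval_add[of m \<psi> "B q" "- t q" "B p"] by (simp add: t_def)
    then show ?thesis using nb that p by (auto simp: null_basis_def t_def)
  qed
  have span: "\<exists>c. \<forall>e<m. w e = (\<Sum>q\<in>?J. c q * ?E q e)" if w: "\<forall>\<psi>\<in>insert \<phi> \<Phi>. lval m \<psi> w = 0" for w
  proof -
    obtain c where c: "\<And>e. e < m \<Longrightarrow> w e = (\<Sum>q\<in>I. c q * B q e)"
      using w by (auto intro: null_basis_span[OF nb])
    have "0 = lval m \<phi> w" using w by simp
    also have "\<dots> = (\<Sum>q\<in>I. c q * lval m \<phi> (B q))"
      using lval_cong[of m w "\<lambda>e. \<Sum>q\<in>I. c q * B q e" \<phi>] c by (simp add: lval_sum)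
    finally have "(\<Sum>q\<in>I. c q * t q) = 0" by (simp add: t_def flip: sum_divide_distrib)
    moreover have "t p = 1" using p by (simp add: t_def)
    \<comment> \<open>As \<open>t p = 1\<close>, the vanishing of \<open>\<phi>\<close> on
      \<open>w\<close> forces this pivot coefficient.\<close>
    ultimately have "c(p := - (\<Sum>q\<in>?J. c q * t q)) = c"
      using p by (auto simp: sum.remove[of I p] add_eq_0_iff fun_eq_iff)
    then have "\<forall>e<m. w e = (\<Sum>q\<in>?J. c q * ?E q e)" unfolding E using c by simp
    then show ?thesis by blast
  qed
  have indep: "\<forall>q\<in>?J. c q = 0" if c: "\<forall>e<m. (\<Sum>q\<in>?J. c q * ?E q e) = 0" for c
  proof -
    have *: "\<forall>q\<in>I. (c(p := - (\<Sum>q\<in>?J. c q * t q))) q = 0"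
      using c unfolding E by (rule null_basis_indep[OF nb])
    show ?thesis
    proof
      fix q assume "q \<in> ?J"
      then show "c q = 0" using bspec[OF *, of q] by simp
    qed
  qed
  show ?thesis
    unfolding null_basis_def
  proof (intro conjI allI impI)
    show "\<forall>q\<in>?J. \<forall>\<psi>\<in>insert \<phi> \<Phi>. lval m \<psi> (?E q) = 0" by (intro ballI z)
  next
    fix w assume "\<forall>\<psi>\<in>insert \<phi> \<Phi>. lval m \<psi> w = 0"
    then show "\<exists>c. \<forall>e<m. w e = (\<Sum>q\<in>?J. c q * ?E q e)" by (rule span)
  next
    fix c assume "\<forall>e<m. (\<Sum>q\<in>?J. c q * ?E q e) = 0"
    then show "\<forall>q\<in>?J. c q = 0" by (rule indep)
  qed
qed

text \<open>Lets the vectors that survive an elimination be numbered consecutively again.\<close>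

lemma null_basis_reindex:
  assumes nb: "null_basis m \<Phi> I B" and bij: "bij_betw \<sigma> J I"
  shows "null_basis m \<Phi> J (\<lambda>q. B (\<sigma> q))"
proof -
  have I: "I = \<sigma> ` J" and inj: "inj_on \<sigma> J" using bij by (auto simp: bij_betw_def)
  have eq: "(\<Sum>q\<in>J. c (\<sigma> q) * B (\<sigma> q) e) = (\<Sum>q\<in>I. c q * B q e)" for c e
    using sum.reindex_bij_betw[OF bij, of "\<lambda>q. c q * B q e"] .
  have indep: "\<forall>q\<in>J. c q = 0" if c: "\<forall>e<m. (\<Sum>q\<in>J. c q * B (\<sigma> q) e) = 0" for c
  proof -
    let ?c = "\<lambda>q. c (inv_into J \<sigma> q)"
    have "(\<Sum>q\<in>J. ?c (\<sigma> q) * B (\<sigma> q) e) = (\<Sum>q\<in>J. c q * B (\<sigma> q) e)" for e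
      by (rule sum.cong) (use inj in auto)
    then have "\<forall>e<m. (\<Sum>q\<in>I. ?c q * B q e) = 0" using c eq[of ?c] by simp
    then have "\<forall>q\<in>I. ?c q = 0" by (rule null_basis_indep[OF nb])
    then show ?thesis using inj I by auto
  qed
  have span: "\<exists>c. \<forall>e<m. w e = (\<Sum>q\<in>J. c q * B (\<sigma> q) e)" if w: "\<forall>\<phi>\<in>\<Phi>. lval m \<phi> w = 0" for w
  proof -
    obtain c where "\<And>e. e < m \<Longrightarrow> w e = (\<Sum>q\<in>I. c q * B q e)"
      using null_basis_span[OF nb w] by blast
    then show ?thesis by (intro exI[of _ "\<lambda>q. c (\<sigma> q)"]) (simp add: eq)
  qed
  have "\<forall>q\<in>J. \<forall>\<phi>\<in>\<Phi>. lval m \<phi> (B (\<sigma> q)) = 0"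
    using null_basis_zero[OF nb] I by blast
  then show ?thesis unfolding null_basis_def using span indep by (intro conjI allI impI) auto
qed

text \<open>Row \<open>i\<close> is the block of \<open>n\<close> consecutive indices starting at
  \<open>i * n\<close>.\<close>

lemma sum_square: "(\<Sum>e<n * n. f (e div n) (e mod n)) = (\<Sum>i<n. \<Sum>j<n. f i j)"
  for f :: "nat \<Rightarrow> nat \<Rightarrow> 'b :: comm_monoid_add"
proof -
  have "(\<Sum>i<n. \<Sum>j<n. f i j) = (\<Sum>i<n. \<Sum>e\<in>{i * n..<i * n + n}. f (e div n) (e mod n))"
  proof (rule sum.cong[OF refl])
    fix i
    show "(\<Sum>j<n. f i j) = (\<Sum>e\<in>{i * n..<i * n + n}. f (e div n) (e mod n))"
      by (rule sum.reindex_bij_witness[of _ "\<lambda>e. e - i * n" "\<lambda>j. i * n + j"])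
        (auto simp: div_nat_eqI mult.commute)
  qed
  also have "\<dots> = (\<Sum>e<n * n. f (e div n) (e mod n))" by (rule sum.nat_group)
  finally show ?thesis by simp
qed

section \<open>Derivatives from values\<close>

text \<open>Up to sign the sum is the d-th finite difference at 0, which annihilates polynomials of
  degree below \<open>d\<close>. Pascal's rule trades one unit of \<open>d\<close> for passing from
  \<open>p\<close> to its negated first difference \<open>q\<close>.\<close>

lemma alternating_binomial_sum_eq_0:
  fixes p :: "complex poly"
  assumes "degree p < d"
  shows "(\<Sum>k\<le>d. (-1) ^ k * of_nat (d choose k) * poly p (of_nat k)) = 0"
  using assms
proof (induction d arbitrary: p)
  case 0
  then show ?case by simp
next
  case (Suc d)
  define q where "q = p - pcompose p [:1, 1:]"
  have pq: "poly q z = poly p z - poly p (z + 1)" for z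
    by (simp add: q_def poly_pcompose add.commute)
  have sum: "(\<Sum>k\<le>Suc d. (-1) ^ k * of_nat (Suc d choose k) * poly p (of_nat k)) =
     (\<Sum>k\<le>d. (-1) ^ k * of_nat (d choose k) * poly q (of_nat k))"
  proof -
    have "(\<Sum>k\<le>Suc d. (-1) ^ k * of_nat (Suc d choose k) * poly p (of_nat k)) =
      poly p 0 + (\<Sum>k\<le>d. (-1) ^ Suc k * of_nat ((d choose Suc k) + (d choose k)) * poly p (of_nat (Suc k)))"
      by (subst sum.atMost_Suc_shift) (simp add: add.commute)
    also have "\<dots> = (poly p 0 + (\<Sum>k\<le>d. (-1) ^ Suc k * of_nat (d choose Suc k) * poly p (of_nat (Suc k)))) +
       (\<Sum>k\<le>d. (-1) ^ Suc k * of_nat (d choose k) * poly p (of_nat (Suc k)))"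
      by (simp add: ring_distribs sum.distrib sum_negf sum_subtractf)
    also have "poly p 0 + (\<Sum>k\<le>d. (-1) ^ Suc k * of_nat (d choose Suc k) * poly p (of_nat (Suc k))) =
       (\<Sum>k\<le>Suc d. (-1) ^ k * of_nat (d choose k) * poly p (of_nat k))"
      by (subst sum.atMost_Suc_shift) simp
    also have "\<dots> = (\<Sum>k\<le>d. (-1) ^ k * of_nat (d choose k) * poly p (of_nat k))"
      by simp
    finally show ?thesis
      by (simp add: pq ring_distribs sum_subtractf sum_negf add.commute)
  qed
  show ?case
  \<comment> \<open>The degree of a constant cannot drop further, but then \<open>q\<close> is
    0.\<close>
  proof (cases "degree p = 0")
    case True
    then obtain c where "p = [:c:]" by (metis degree_eq_zeroE)
    then have "q = 0" by (simp add: q_def)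
    then show ?thesis unfolding sum by simp
  next
    case False
    have "degree q < degree p"
    proof -
      have le: "degree q \<le> degree p"
        unfolding q_def by (intro degree_diff_le) (simp_all add: degree_pcompose)
      \<comment> \<open>\<open>p\<close> and its shift have the same leading coefficient.\<close>
      have "coeff q (degree p) = 0"
        using lead_coeff_comp[of "[:1, 1:]" p] by (simp add: q_def degree_pcompose)
      then show ?thesis using le False
        by (metis coeff_0_degree_minus_1 le_neq_implies_less leading_coeff_0_iff degree_0)
    qed
    then have "degree q < d" using Suc.prems by linarith
    then show ?thesis unfolding sum by (rule Suc.IH)
  qed
qed

text \<open>The previous lemma for the polynomial \<open>(g(z) - g(0)) / z\<close>, whose value at 0 is the derivative.\<close>

lemma derivative_from_values:
  fixes g :: "complex poly"
  assumes "degree g \<le> d" "1 \<le> d"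
  shows "(\<Sum>k<d. (-1) ^ k * of_nat (d choose Suc k) * ((poly g (of_nat (Suc k)) - poly g 0) / of_nat (Suc k))) = coeff g 1"
proof -
  obtain c h where g: "g = pCons c h" by (cases g)
  have dh: "degree h < d" using assms by (cases "h = 0") (auto simp: g)
  have "0 = (\<Sum>k\<le>d. (-1) ^ k * of_nat (d choose k) * poly h (of_nat k))"
    using alternating_binomial_sum_eq_0[OF dh] by simp
  also have "\<dots> = poly h 0 + (\<Sum>k<d. (-1) ^ Suc k * of_nat (d choose Suc k) * poly h (of_nat (Suc k)))"
    by (subst sum.atMost_shift) simp
  also have "\<dots> = poly h 0 - (\<Sum>k<d. (-1) ^ k * of_nat (d choose Suc k) * poly h (of_nat (Suc k)))"
    by (simp add: sum_negf)
  finally have "(\<Sum>k<d. (-1) ^ k * of_nat (d choose Suc k) * poly h (of_nat (Suc k))) = poly h 0" by simp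
  moreover have "(poly g (of_nat (Suc k)) - poly g 0) / of_nat (Suc k) = poly h (of_nat (Suc k))" for k
    unfolding g by (simp del: of_nat_Suc)
  ultimately show ?thesis by (simp add: g poly_0_coeff_0)
qed

text \<open>The recursion by which the program updates the signed binomial coefficients in boundedly
  many complex operations.\<close>

lemma alternating_binomial_Suc:
  "(-1) ^ Suc k * of_nat (d choose Suc k) =
   ((-1) ^ k * of_nat (d choose k)) * ((of_nat k - of_nat d) / of_nat (Suc k) :: complex)"
proof -
  have "Suc k * (d choose Suc k) = (d - k) * (d choose k)"
    by (metis binomial_absorb_comp binomial_absorption mult.commute)
  then have "of_nat (Suc k) * of_nat (d choose Suc k) = (of_nat (d - k) * of_nat (d choose k) :: complex)"
    by (metis of_nat_mult)
  also have "\<dots> = (of_nat d - of_nat k) * of_nat (d choose k)"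
    \<comment> \<open>For \<open>k > d\<close> the truncated difference and the binomial coefficient
      are both 0, so both sides vanish.\<close>
    by (cases "k \<le> d") (simp_all add: of_nat_diff)
  finally have "of_nat (d choose Suc k) =
      (of_nat d - of_nat k) * of_nat (d choose k) / (of_nat (Suc k) :: complex)"
    by (simp add: field_simps del: of_nat_Suc)
  moreover have "(-1) ^ Suc k * ((D - S) * X / T) = ((-1) ^ k * X) * ((S - D) / T)" for D S X T :: complex
    by (simp add: diff_divide_distrib algebra_simps)
  ultimately show ?thesis by metis
qed

section \<open>Matrices as vectors\<close>

abbreviation flat_mat :: "nat \<Rightarrow> complex mat \<Rightarrow> nat \<Rightarrow> complex" where
  "flat_mat n C \<equiv> (\<lambda>e. C $$ (e div n, e mod n))"

abbreviation unflat :: "nat \<Rightarrow> (nat \<Rightarrow> complex) \<Rightarrow> complex mat" where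
  "unflat n w \<equiv> mat n n (\<lambda>(i, j). w (i * n + j))"

lemma flat_index:
  fixes e n :: nat
  assumes "e < n * n"
  shows "e div n < n" "e mod n < n"
proof -
  have "0 < n" using assms by (cases n) auto
  then show "e div n < n" "e mod n < n" using assms by (simp_all add: less_mult_imp_div_less)
qed

lemma flat_unflat: "e < n * n \<Longrightarrow> flat_mat n (unflat n w) e = w e"
  using flat_index[of e n] by simp

abbreviation submat :: "nat \<Rightarrow> complex mat set \<Rightarrow> (complex, complex mat) module" where
  "submat n W \<equiv> (module_mat TYPE(complex) n n)\<lparr>carrier := W\<rparr>"

lemma submat_vectorspace:
  assumes "W \<subseteq> carrier_mat n n" "0\<^sub>m n n \<in> W" "\<And>A B. A \<in> W \<Longrightarrow> B \<in> W \<Longrightarrow> A + B \<in> W"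
    "\<And>c A. A \<in> W \<Longrightarrow> c \<cdot>\<^sub>m A \<in> W"
  shows "vectorspace class_ring (submat n W)"
proof -
  interpret V: vectorspace class_ring "module_mat TYPE(complex) n n" by (rule matrix_vs)
  have "submodule class_ring W (module_mat TYPE(complex) n n)"
    by (rule submodule.intro[OF V.module_axioms]) (use assms in \<open>auto simp: module_mat_simps\<close>)
  then show ?thesis by (intro V.subspace_is_vs subspace.intro V.vectorspace_axioms)
qed

text \<open>Sums in the restricted module are abstract; reading entries turns them into ordinary
  complex sums.\<close>

lemma finsum_submat_index:
  assumes "vectorspace class_ring (submat n W)" "W \<subseteq> carrier_mat n n" "finite A" "f \<in> A \<rightarrow> W" "i < n" "j < n"
  shows "finsum (submat n W) f A $$ (i, j) = (\<Sum>v\<in>A. f v $$ (i, j))"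
proof -
  interpret S: vectorspace class_ring "submat n W" by fact
  show ?thesis using assms(3,4)
  proof (induction A rule: finite_induct)
    case empty
    show ?case using assms(5,6) by (simp add: module_mat_simps)
  next
    case (insert x A)
    have "finsum (submat n W) f A \<in> W" using insert.prems S.finsum_closed[of f A] by simp
    then have c: "finsum (submat n W) f A \<in> carrier_mat n n" using assms(2) by blast
    have "finsum (submat n W) f (insert x A) = f x + finsum (submat n W) f A"
      using insert by (subst S.finsum_insert) (auto simp: module_mat_simps)
    then show ?case using insert c assms(5,6) by simp
  qed
qed

text \<open>Carries coordinates over to the library notion of a basis. That notion is about sets, so
  the list of matrices must also be free of repetitions.\<close>

lemma null_basis_imp_lie_algebra_basis:
  assumes nb: "null_basis (n * n) \<Phi> {..<r::nat} B"
    and lie: "\<And>C. C \<in> carrier_mat n n \<Longrightarrow>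
      C \<in> lie_algebra n P \<longleftrightarrow> (\<forall>\<phi>\<in>\<Phi>. lval (n * n) \<phi> (flat_mat n C) = 0)"
  defines "M \<equiv> (\<lambda>q. unflat n (B q))"
  shows "inj_on M {..<r} \<and> is_lie_algebra_basis n P (M ` {..<r})"
proof -
  define W where "W = lie_algebra n P"
  have Wc: "W \<subseteq> carrier_mat n n" by (auto simp: W_def lie_algebra_def)
  have W: "C \<in> W \<longleftrightarrow> (\<forall>\<phi>\<in>\<Phi>. lval (n * n) \<phi> (flat_mat n C) = 0)" if "C \<in> carrier_mat n n" for C
    using lie[OF that] by (simp add: W_def)
  have add: "A + B' \<in> W" if "A \<in> W" "B' \<in> W" for A B'
  proof -
    have "A \<in> carrier_mat n n" "B' \<in> carrier_mat n n" using that Wc by auto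
    moreover from this have "lval (n * n) \<phi> (flat_mat n (A + B')) =
        lval (n * n) \<phi> (\<lambda>e. flat_mat n A e + 1 * flat_mat n B' e)" for \<phi>
      by (intro lval_cong) (simp add: flat_index)
    ultimately show ?thesis
      using that W lval_add[of "n * n" _ "flat_mat n A" 1 "flat_mat n B'"] by simp
  qed
  have smult: "c \<cdot>\<^sub>m A \<in> W" if "A \<in> W" for c A
  proof -
    have "A \<in> carrier_mat n n" using that Wc by auto
    moreover from this have "lval (n * n) \<phi> (flat_mat n (c \<cdot>\<^sub>m A)) = c * lval (n * n) \<phi> (flat_mat n A)" for \<phi>
      unfolding lval_def sum_distrib_left by (intro sum.cong) (simp_all add: flat_index)
    ultimately show ?thesis using that W by simp
  qed
  have zero: "0\<^sub>m n n \<in> W"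
    by (simp add: W lval_def flat_index)
  have vs: "vectorspace class_ring (submat n W)"
    using Wc zero add smult by (rule submat_vectorspace)
  interpret S: vectorspace class_ring "submat n W" by fact
  have indep: "\<forall>q\<in>{..<r}. c q = 0" if "\<forall>e<n * n. (\<Sum>q<r. c q * B q e) = 0" for c
    using null_basis_indep[OF nb that] .
  have inj: "inj_on M {..<r}"
  proof (rule inj_onI, rule ccontr)
    fix p q assume pq: "p \<in> {..<r}" "q \<in> {..<r}" "M p = M q" "p \<noteq> q"
    have Beq: "B p e = B q e" if "e < n * n" for e
      using arg_cong[OF pq(3), of "\<lambda>A. flat_mat n A e"] flat_unflat[OF that] by (simp add: M_def)
    \<comment> \<open>Equal matrices at \<open>p\<close> and \<open>q\<close> would give a
      nontrivial relation with coefficients 1 and -1.\<close>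
    let ?c = "\<lambda>k. if k = p then 1 else if k = q then - 1 else 0 :: complex"
    have "(\<Sum>k<r. ?c k * B k e) = 0" if "e < n * n" for e
    proof -
      have "(\<Sum>k<r. ?c k * B k e) = (\<Sum>k\<in>{p, q}. ?c k * B k e)"
        by (rule sum.mono_neutral_right) (use pq in auto)
      then show ?thesis using pq Beq[OF that] by simp
    qed
    then have "?c p = 0" using indep[of ?c] pq by blast
    then show False by simp
  qed
  have MW: "M q \<in> W" if "q < r" for q
  proof -
    have "lval (n * n) \<phi> (flat_mat n (M q)) = lval (n * n) \<phi> (B q)" for \<phi>
      unfolding M_def by (intro lval_cong flat_unflat)
    then show ?thesis using W[of "M q"] null_basis_zero[OF nb, of q] that by (auto simp: M_def)
  qed
  have lc: "S.lincomb a (M ` {..<r}) $$ (i, j) = (\<Sum>q<r. a (M q) * B q (i * n + j))"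
    if "i < n" "j < n" for a i j
  proof -
    have "S.lincomb a (M ` {..<r}) $$ (i, j) = (\<Sum>v\<in>M ` {..<r}. (a v \<cdot>\<^sub>m v) $$ (i, j))"
      unfolding S.lincomb_def
      by (subst finsum_submat_index[OF vs Wc]) (use MW smult that in \<open>auto simp: module_mat_simps\<close>)
    also have "\<dots> = (\<Sum>q<r. (a (M q) \<cdot>\<^sub>m M q) $$ (i, j))"
      by (simp add: sum.reindex[OF inj])
    also have "\<dots> = (\<Sum>q<r. a (M q) * B q (i * n + j))"
      by (rule sum.cong) (use that in \<open>auto simp: M_def\<close>)
    finally show ?thesis .
  qed
  have lcW: "S.lincomb a (M ` {..<r}) \<in> W" for a
    using S.lincomb_closed[of "M ` {..<r}" a] MW by (auto simp: class_ring_simps)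
  have sub: "M ` {..<r} \<subseteq> W" using MW by auto
  have lin_indpt: "S.lin_indpt (M ` {..<r})"
  proof (rule S.finite_lin_indpt2)
    fix a assume "S.lincomb a (M ` {..<r}) = \<zero>\<^bsub>submat n W\<^esub>"
    then have z: "S.lincomb a (M ` {..<r}) = 0\<^sub>m n n" by (simp add: module_mat_simps)
    have "(\<Sum>q<r. a (M q) * B q e) = 0" if e: "e < n * n" for e
      using lc[OF flat_index[OF e], of a] z flat_index[OF e] by simp
    then have "\<forall>q\<in>{..<r}. a (M q) = 0" by (intro indep) blast
    then show "\<forall>v\<in>M ` {..<r}. a v = \<zero>\<^bsub>class_ring\<^esub>" by (simp add: class_ring_simps)
  qed (use sub in auto)
  have span: "S.span (M ` {..<r}) = W"
  proof
    show "S.span (M ` {..<r}) \<subseteq> W"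
      using lcW by (subst S.finite_span) (use sub in auto)
    show "W \<subseteq> S.span (M ` {..<r})"
    proof
      fix C assume C: "C \<in> W"
      then have Cc: "C \<in> carrier_mat n n" using Wc by auto
      then have "\<forall>\<phi>\<in>\<Phi>. lval (n * n) \<phi> (flat_mat n C) = 0" using W C by simp
      then obtain c where c: "\<And>e. e < n * n \<Longrightarrow> flat_mat n C e = (\<Sum>q<r. c q * B q e)"
        by (rule null_basis_span[OF nb]) blast
      \<comment> \<open>The coefficients of \<open>lincomb\<close> are indexed by matrices, so
        \<open>inv_into\<close> recovers the position.\<close>
      let ?a = "\<lambda>v. c (inv_into {..<r} M v)"
      have "C = S.lincomb ?a (M ` {..<r})"
      proof (rule eq_matI)
        have "S.lincomb ?a (M ` {..<r}) \<in> carrier_mat n n" using lcW Wc by blast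
        then show dims: "dim_row C = dim_row (S.lincomb ?a (M ` {..<r}))"
          "dim_col C = dim_col (S.lincomb ?a (M ` {..<r}))" using Cc by auto
        fix i j assume "i < dim_row (S.lincomb ?a (M ` {..<r}))" "j < dim_col (S.lincomb ?a (M ` {..<r}))"
        then have ij: "i < n" "j < n" using dims Cc by auto
        have "i * n + j < n * n"
        proof -
          have "i * n + j < Suc i * n" using ij by simp
          also have "\<dots> \<le> n * n" using ij by (intro mult_le_mono1) simp
          finally show ?thesis .
        qed
        from c[OF this] have "C $$ (i, j) = (\<Sum>q<r. c q * B q (i * n + j))" using ij by simp
        then show "C $$ (i, j) = S.lincomb ?a (M ` {..<r}) $$ (i, j)"
          by (simp add: lc[OF ij] inv_into_f_f[OF inj])
      qed
      then show "C \<in> S.span (M ` {..<r})"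
        by (subst S.finite_span) (use sub in \<open>auto simp: class_ring_simps\<close>)
    qed
  qed
  have "S.basis (M ` {..<r})"
    unfolding S.basis_def using lin_indpt span sub by simp
  then show ?thesis using inj by (simp add: is_lie_algebra_basis_def W_def)
qed

text \<open>For fixed \<open>x\<close> the derivative at \<open>x\<close> is linear in the matrix;
  these are its coefficients in row-major order.\<close>

definition lie_functional :: "nat \<Rightarrow> mpoly \<Rightarrow> (nat \<Rightarrow> complex) \<Rightarrow> nat \<Rightarrow> complex" where
  "lie_functional n P x e = x (e mod n) * meval (mderiv (e div n) P) x"

lemma lval_lie_functional:
  "lval (n * n) (lie_functional n P x) (flat_mat n C) = meval (lie_deriv n C P) x"
  unfolding lval_def lie_functional_def meval_lie_deriv
  using sum_square[of "\<lambda>i j. x j * meval (mderiv i P) x * C $$ (i, j)" n]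
  by (simp add: mult_ac)

lemma lval_lie_functional_unflat:
  "lval (n * n) (lie_functional n P x) w = meval (lie_deriv n (unflat n w) P) x"
  unfolding lval_lie_functional[symmetric] by (rule lval_cong) (simp add: flat_unflat[simplified])

text \<open>The derivative of \<open>f\<close> at \<open>x\<close> in the direction \<open>W x\<close>, where \<open>w\<close> lists the rows of the matrix \<open>W\<close>.\<close>

definition interpolated_deriv ::
    "((nat \<Rightarrow> complex) \<Rightarrow> complex) \<Rightarrow> nat \<Rightarrow> nat \<Rightarrow> (nat \<Rightarrow> complex) \<Rightarrow> (nat \<Rightarrow> complex) \<Rightarrow> complex" where
  "interpolated_deriv f n d x w = (\<Sum>k<d. (-1) ^ k * of_nat (d choose Suc k) *
     ((f (\<lambda>i. x i + of_nat (Suc k) * (\<Sum>j<n. w (i * n + j) * x j)) - f x) / of_nat (Suc k)))"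

text \<open>With \<open>W\<close> the matrix of \<open>w\<close>, \<open>P\<close> restricted to the
  line through \<open>x\<close> in direction \<open>W x\<close> becomes a polynomial
  \<open>G\<close> of degree at most \<open>d\<close>, whose linear coefficient is the derivative
  wanted.\<close>

lemma interpolated_deriv_eq:
  assumes P: "P = (\<Prod>k<d. lform n (a k))" and "1 \<le> d"
  shows "interpolated_deriv (meval P) n d x w = lval (n * n) (lie_functional n P x) w"
proof -
  define y where "y i = (\<Sum>j<n. w (i * n + j) * x j)" for i
  define g where "g k = [:lval n (a k) x, lval n (a k) y:]" for k
  define G where "G = prod g {..<d}"
  have G: "poly G z = meval P (\<lambda>i. x i + z * y i)" for z
  proof -
    have "poly (g k) z = lval n (a k) (\<lambda>i. x i + z * y i)" for k by (simp add: g_def lval_add)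
    then show ?thesis by (simp add: G_def P poly_prod meval_prod)
  qed
  have "degree G \<le> (\<Sum>k<d. degree (g k))"
    using degree_prod_sum_le[of "{..<d}" g] by (simp add: G_def comp_def)
  also have "\<dots> \<le> (\<Sum>k<d. 1)" by (rule sum_mono) (simp add: g_def)
  finally have deg: "degree G \<le> d" by simp
  \<comment> \<open>Applying a form to \<open>W x\<close> is the same as applying its image under
    \<open>act\<close> to \<open>x\<close>.\<close>
  have ly: "lval n (a k) y = lval n (act n (unflat n w) (a k)) x" for k
  proof -
    have "lval n (a k) y = (\<Sum>i<n. \<Sum>j<n. a k i * w (i * n + j) * x j)"
      by (simp add: lval_def y_def sum_distrib_left mult_ac)
    also have "\<dots> = (\<Sum>j<n. \<Sum>i<n. a k i * w (i * n + j) * x j)" by (rule sum.swap)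
    also have "\<dots> = lval n (act n (unflat n w) (a k)) x"
      by (simp add: lval_def sum_distrib_right)
    finally show ?thesis .
  qed
  have "interpolated_deriv (meval P) n d x w = coeff G 1"
    using derivative_from_values[OF deg assms(2)] by (simp add: G interpolated_deriv_def y_def)
  also have "coeff G 1 = poly (pderiv G) 0" by (simp add: poly_0_coeff_0 coeff_pderiv)
  also have "\<dots> = (\<Sum>k<d. (\<Prod>j\<in>{..<d}-{k}. lval n (a j) x) * lval n (a k) y)"
    by (simp add: G_def pderiv_prod poly_sum poly_prod g_def pderiv_pCons mult.commute)
  also have "\<dots> = prod_deriv n d a (\<lambda>k. act n (unflat n w) (a k)) x"
    by (simp add: prod_deriv_def ly mult.commute)
  also have "\<dots> = lval (n * n) (lie_functional n P x) w"
    unfolding lval_lie_functional_unflat P meval_lie_deriv_product ..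
  finally show ?thesis .
qed

lemma meval_lform_product_cong:
  assumes "P = (\<Prod>k<d. lform n (a k))" "\<And>i. i < n \<Longrightarrow> x i = y i"
  shows "meval P x = meval P y"
  using assms by (simp add: meval_prod lval_def)

text \<open>The parameter \<open>l = 0\<close> yields the points of the moment curve themselves, so \<open>u = 0\<close> is not
  needed as in \<open>\<Lambda>(d, n)\<close>.\<close>

lemma lie_algebra_iff_functionals:
  assumes P: "P = (\<Prod>k<d. lform n (a k))" and nz: "\<And>k. k < d \<Longrightarrow> \<exists>i<n. a k i \<noteq> 0"
    and "1 \<le> d" and N: "N = 2 * (d * d * n) + 2" and C: "C \<in> carrier_mat n n"
  shows "C \<in> lie_algebra n P \<longleftrightarrow>
    (\<forall>s<N. \<forall>t<N. \<forall>l<N.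
      lval (n * n) (lie_functional n P (\<lambda>i. of_nat s ^ i + of_nat l * of_nat t ^ i)) (flat_mat n C) = 0)"
proof
  assume "C \<in> lie_algebra n P"
  then show "\<forall>s<N. \<forall>t<N. \<forall>l<N.
      lval (n * n) (lie_functional n P (\<lambda>i. of_nat s ^ i + of_nat l * of_nat t ^ i)) (flat_mat n C) = 0"
    by (simp add: lval_lie_functional[simplified] lie_algebra_def lie_deriv_def)
next
  assume *: "\<forall>s<N. \<forall>t<N. \<forall>l<N.
      lval (n * n) (lie_functional n P (\<lambda>i. of_nat s ^ i + of_nat l * of_nat t ^ i)) (flat_mat n C) = 0"
  have ev: "meval (lie_deriv n C P) (\<lambda>i. of_nat s ^ i + of_nat l * of_nat t ^ i) = 0"
    if "s < N" "t < N" "l < N" for s t l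
    using * that unfolding lval_lie_functional by blast
  \<comment> \<open>The first factor has a nonzero coefficient, so there is at least one
    variable.\<close>
  have n: "1 \<le> n" using nz[of 0] assms(3) by force
  have "d \<le> d * d * n" "d * n \<le> d * d * n" using assms(3) n by simp_all
  moreover have "d * d * (n - 1) + 1 \<le> d * d * n" "d * (n - 1) + 1 \<le> d * n"
    using assms(3) n by (cases n; simp)+
  \<comment> \<open>\<open>N\<close> is a crude common bound above all three parameter
    ranges.\<close>
  ultimately have N': "d\<^sup>2 * (n - 1) + 1 < N" "d * (n - 1) + 1 < N" "2 * d + 1 < N"
    unfolding N power2_eq_square by linarith+
  show "C \<in> lie_algebra n P"
  proof (rule mem_lie_algebra[OF P nz C])
    fix t assume "t \<in> {1..d * (n - 1) + 1}"
    then show "meval (lie_deriv n C P) (\<lambda>i. of_nat t ^ i) = 0" using ev[of t 0 0] N' by simp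
  next
    fix s t l assume "s \<in> {1..d\<^sup>2 * (n - 1) + 1}" "t \<in> {1..d * (n - 1) + 1}" "l \<in> {1..2 * d + 1}"
    then show "meval (lie_deriv n C P) (\<lambda>i. of_nat s ^ i + of_nat l * of_nat t ^ i) = 0"
      using ev[of s t l] N' by simp
  qed simp
qed

section \<open>Programs with bounded loops\<close>

text \<open>Programs whose only loops run over the values below a register. Their semantics is a total
  function on states, and a tame program, which cannot produce a register value beyond the initial
  maximum (or 1), runs in time polynomial in that maximum.\<close>

datatype loop_prog = LReg vname nexp | LElem vname nexp cexp | LQuery vname nexp vname
  | LSeq loop_prog loop_prog (infixr ";;" 60) | LIf bexp loop_prog | LFor vname vname loop_prog

fun lp_com :: "loop_prog \<Rightarrow> com" where
  "lp_com (LReg x e) = SetReg x e"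
| "lp_com (LElem a e g) = SetElem a e g"
| "lp_com (LQuery a e b) = Query a e b"
| "lp_com (LSeq p q) = Then (lp_com p) (lp_com q)"
| "lp_com (LIf b p) = Cond b (lp_com p) Skip"
| "lp_com (LFor i m p) = Then (SetReg i (NConst 0))
     (While (BLess (NReg i) (NReg m)) (Then (lp_com p) (SetReg i (NAdd (NReg i) (NConst 1)))))"

abbreviation set_reg :: "vname \<Rightarrow> nat \<Rightarrow> state \<Rightarrow> state" where
  "set_reg x k s \<equiv> s\<lparr>reg := (reg s)(x := k)\<rparr>"

abbreviation set_arr :: "vname \<Rightarrow> nat \<Rightarrow> complex \<Rightarrow> state \<Rightarrow> state" where
  "set_arr a k c s \<equiv> s\<lparr>arr := (arr s)(a := (arr s a)(k := c))\<rparr>"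

text \<open>A loop reads its bound once and sets the counter anew in every round. This agrees with
  the while loop of \<open>lp_com\<close> when the body changes neither, as \<open>tame\<close>
  demands.\<close>

primrec exec :: "((nat \<Rightarrow> complex) \<Rightarrow> complex) \<Rightarrow> loop_prog \<Rightarrow> state \<Rightarrow> state" where
  "exec f (LReg x e) = (\<lambda>s. set_reg x (nval e s) s)"
| "exec f (LElem a e g) = (\<lambda>s. set_arr a (nval e s) (cval g s) s)"
| "exec f (LQuery a e b) = (\<lambda>s. set_arr a (nval e s) (f (arr s b)) s)"
| "exec f (LSeq p q) = (\<lambda>s. exec f q (exec f p s))"
| "exec f (LIf b p) = (\<lambda>s. if bval b s then exec f p s else s)"
| "exec f (LFor i m p) = (\<lambda>s.
     set_reg i (reg s m) (fold (\<lambda>k s. exec f p (set_reg i k s)) [0..<reg s m] s))"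

fun mregs :: "loop_prog \<Rightarrow> vname set" where
  "mregs (LReg x e) = {x}"
| "mregs (LElem a e g) = {}"
| "mregs (LQuery a e b) = {}"
| "mregs (LSeq p q) = mregs p \<union> mregs q"
| "mregs (LIf b p) = mregs p"
| "mregs (LFor i m p) = insert i (mregs p)"

fun marrs :: "loop_prog \<Rightarrow> vname set" where
  "marrs (LReg x e) = {}"
| "marrs (LElem a e g) = {a}"
| "marrs (LQuery a e b) = {a}"
| "marrs (LSeq p q) = marrs p \<union> marrs q"
| "marrs (LIf b p) = marrs p"
| "marrs (LFor i m p) = marrs p"

lemma exec_Seq: "exec f (p ;; q) s = exec f q (exec f p s)"
  by simp

lemma fold_upt_invariant:
  assumes "I 0 s" "\<And>k s. k < M \<Longrightarrow> I k s \<Longrightarrow> I (Suc k) (F k s)"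
  shows "I M (fold F [0..<M] s)"
proof -
  have "k \<le> M \<Longrightarrow> I k (fold F [0..<k] s)" for k
    by (induction k) (use assms in auto)
  then show ?thesis by blast
qed

text \<open>The invariant speaks about the state before the counter is set to \<open>k\<close>.
  After the loop the counter stands at the bound, so the conclusion is checked in that
  state.\<close>

lemma exec_For:
  assumes "reg s m = M" "I 0 s"
    and "\<And>k s. k < M \<Longrightarrow> I k s \<Longrightarrow> I (Suc k) (exec f p (set_reg i k s))"
    and "\<And>s. I M s \<Longrightarrow> Q (set_reg i M s)"
  shows "Q (exec f (LFor i m p) s)"
  using fold_upt_invariant[of I s M "\<lambda>k s. exec f p (set_reg i k s)", OF assms(2,3)] assms(1,4)
  by simp

lemma exec_frame_reg: "x \<notin> mregs p \<Longrightarrow> reg (exec f p s) x = reg s x"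
proof (induction p arbitrary: s)
  case (LFor i m p)
  show ?case
    by (rule exec_For[where I = "\<lambda>_ s'. reg s' x = reg s x" and M = "reg s m"])
      (use LFor in auto)
qed auto

lemma exec_frame_arr: "a \<notin> marrs p \<Longrightarrow> arr (exec f p s) a = arr s a"
proof (induction p arbitrary: s)
  case (LFor i m p)
  show ?case
    by (rule exec_For[where I = "\<lambda>_ s'. arr s' a = arr s a" and M = "reg s m"])
      (use LFor in auto)
qed auto

section \<open>Register growth and running time\<close>

fun flat :: "nexp \<Rightarrow> bool" where
  "flat (NConst k) \<longleftrightarrow> k \<le> 1"
| "flat (NReg x) \<longleftrightarrow> True"
| "flat (NSub a b) \<longleftrightarrow> flat a"
| "flat (NAdd a b) \<longleftrightarrow> False"
| "flat (NMul a b) \<longleftrightarrow> False"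

text \<open>Of the assignments only those to registers are restricted, because array writes cannot
  enlarge a register.\<close>

fun tame :: "loop_prog \<Rightarrow> bool" where
  "tame (LReg x e) \<longleftrightarrow> flat e"
| "tame (LElem a e g) \<longleftrightarrow> True"
| "tame (LQuery a e b) \<longleftrightarrow> True"
| "tame (LSeq p q) \<longleftrightarrow> tame p \<and> tame q"
| "tame (LIf b p) \<longleftrightarrow> tame p"
| "tame (LFor i m p) \<longleftrightarrow> tame p \<and> i \<noteq> m \<and> i \<notin> mregs p \<and> m \<notin> mregs p"

text \<open>Every register is replaced by the bound \<open>B\<close>, and a truncated difference by
  its first operand, which leaves polynomials in \<open>B\<close>.\<close>

fun nval_ub :: "nexp \<Rightarrow> nat \<Rightarrow> nat" where
  "nval_ub (NConst k) B = k"
| "nval_ub (NReg x) B = B"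
| "nval_ub (NAdd a b) B = nval_ub a B + nval_ub b B"
| "nval_ub (NSub a b) B = nval_ub a B"
| "nval_ub (NMul a b) B = nval_ub a B * nval_ub b B"

fun ncost_ub :: "nexp \<Rightarrow> nat \<Rightarrow> nat" where
  "ncost_ub (NConst k) B = 1 + k"
| "ncost_ub (NReg x) B = 1 + B"
| "ncost_ub (NAdd a b) B = 1 + ncost_ub a B + ncost_ub b B + (nval_ub a B + nval_ub b B)"
| "ncost_ub (NSub a b) B = 1 + ncost_ub a B + ncost_ub b B + nval_ub a B"
| "ncost_ub (NMul a b) B = 1 + ncost_ub a B + ncost_ub b B + nval_ub a B * nval_ub b B"

fun ccost_ub :: "cexp \<Rightarrow> nat \<Rightarrow> nat" where
  "ccost_ub (COfNat e) B = 1 + ncost_ub e B"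
| "ccost_ub (CElem a e) B = 1 + ncost_ub e B"
| "ccost_ub (CAdd f g) B = 1 + ccost_ub f B + ccost_ub g B"
| "ccost_ub (CSub f g) B = 1 + ccost_ub f B + ccost_ub g B"
| "ccost_ub (CMul f g) B = 1 + ccost_ub f B + ccost_ub g B"
| "ccost_ub (CDiv f g) B = 1 + ccost_ub f B + ccost_ub g B"

fun bcost_ub :: "bexp \<Rightarrow> nat \<Rightarrow> nat" where
  "bcost_ub (BLess a b) B = 1 + ncost_ub a B + ncost_ub b B"
| "bcost_ub (BEq f g) B = 1 + ccost_ub f B + ccost_ub g B"
| "bcost_ub (BNot b) B = 1 + bcost_ub b B"
| "bcost_ub (BAnd b c) B = 1 + bcost_ub b B + bcost_ub c B"

text \<open>In the loop case \<open>6 + 2 * B\<close> covers setting the counter to 0 and the final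
  failing test, and \<open>10 + 4 * B\<close> one successful test with the increment.\<close>

fun time_ub :: "loop_prog \<Rightarrow> nat \<Rightarrow> nat" where
  "time_ub (LReg x e) B = 1 + ncost_ub e B"
| "time_ub (LElem a e g) B = 1 + ncost_ub e B + ccost_ub g B"
| "time_ub (LQuery a e b) B = 1 + ncost_ub e B"
| "time_ub (LSeq p q) B = time_ub p B + time_ub q B"
| "time_ub (LIf b p) B = 2 + bcost_ub b B + time_ub p B"
| "time_ub (LFor i m p) B = 6 + 2 * B + B * (10 + 4 * B + time_ub p B)"

lemma nval_le_ub: "(\<And>x. reg s x \<le> B) \<Longrightarrow> nval e s \<le> nval_ub e B"
  by (induction e) (auto intro: add_mono mult_le_mono le_trans[OF diff_le_self])

text \<open>Truncated subtraction never exceeds its first operand. Sums and products are not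
  \<open>flat\<close>, since assigned in a loop they could make registers grow
  exponentially.\<close>

lemma flat_le: "(\<And>x. reg s x \<le> B) \<Longrightarrow> 1 \<le> B \<Longrightarrow> flat e \<Longrightarrow> nval e s \<le> B"
  by (induction e) (auto intro: le_trans[OF diff_le_self])

lemma ncost_le_ub: "(\<And>x. reg s x \<le> B) \<Longrightarrow> ncost e s \<le> ncost_ub e B"
proof (induction e)
  case (NSub a b)
  have "nval a s - nval b s \<le> nval_ub a B"
    using nval_le_ub[of s B a] NSub.prems by (meson diff_le_self le_trans)
  then show ?case using NSub by (auto intro!: add_mono)
qed (auto intro!: add_mono mult_le_mono nval_le_ub)

lemma ccost_le_ub: "(\<And>x. reg s x \<le> B) \<Longrightarrow> ccost e s \<le> ccost_ub e B"
  by (induction e) (auto intro!: add_mono ncost_le_ub)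

lemma bcost_le_ub: "(\<And>x. reg s x \<le> B) \<Longrightarrow> bcost e s \<le> bcost_ub e B"
  by (induction e) (auto intro!: add_mono ncost_le_ub ccost_le_ub)

text \<open>Time and register bound are proved together, since the time bound of a later part needs
  the register bound in its initial state.\<close>

lemma run_lp_com:
  assumes "tame p" "\<And>x. reg s x \<le> B" "1 \<le> B"
  shows "(\<exists>t \<le> time_ub p B. run f (lp_com p) s t (exec f p s)) \<and> (\<forall>x. reg (exec f p s) x \<le> B)"
  using assms(1,2)
proof (induction p arbitrary: s)
  case (LReg x e)
  have "run f (lp_com (LReg x e)) s (1 + ncost e s) (exec f (LReg x e) s)"
    by (simp add: run.SetReg[simplified])
  moreover have "1 + ncost e s \<le> time_ub (LReg x e) B"
    using ncost_le_ub[of s B e] LReg by simp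
  ultimately show ?case
    using flat_le[of s B e] LReg assms(3) by auto
next
  case (LElem a e g)
  have "run f (lp_com (LElem a e g)) s (1 + ncost e s + ccost g s) (exec f (LElem a e g) s)"
    by (simp add: run.SetElem[simplified])
  moreover have "1 + ncost e s + ccost g s \<le> time_ub (LElem a e g) B"
    using ncost_le_ub[of s B e] ccost_le_ub[of s B g] LElem by (simp add: add_mono)
  ultimately show ?case using LElem.prems by (metis (no_types, lifting) exec_frame_reg mregs.simps(2) empty_iff)
next
  case (LQuery a e b)
  have "run f (lp_com (LQuery a e b)) s (1 + ncost e s) (exec f (LQuery a e b) s)"
    by (simp add: run.Query[simplified])
  moreover have "1 + ncost e s \<le> time_ub (LQuery a e b) B"
    using ncost_le_ub[of s B e] LQuery by simp
  ultimately show ?case using LQuery.prems by (metis (no_types, lifting) exec_frame_reg mregs.simps(3) empty_iff)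
next
  case (LSeq p q)
  from LSeq.IH(1)[of s] LSeq.prems obtain t1
    where t1: "t1 \<le> time_ub p B" "run f (lp_com p) s t1 (exec f p s)"
      and B1: "\<And>x. reg (exec f p s) x \<le> B" by auto
  from LSeq.IH(2)[of "exec f p s"] LSeq.prems B1 obtain t2
    where t2: "t2 \<le> time_ub q B" "run f (lp_com q) (exec f p s) t2 (exec f q (exec f p s))"
      and B2: "\<And>x. reg (exec f q (exec f p s)) x \<le> B" by auto
  show ?case
    using run.Then[OF t1(2) t2(2)] add_mono[OF t1(1) t2(1)] B2 by auto
next
  case (LIf b p)
  from LIf.IH[of s] LIf.prems obtain t1
    where t1: "t1 \<le> time_ub p B" "run f (lp_com p) s t1 (exec f p s)"
      and B1: "\<And>x. reg (exec f p s) x \<le> B" by auto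
  have bc: "bcost b s \<le> bcost_ub b B" using bcost_le_ub LIf.prems by blast
  show ?case
  proof (cases "bval b s")
    case True
    then show ?thesis using run.CondTrue[OF True t1(2), of Skip] t1(1) B1 bc
      by (auto intro!: exI[of _ "1 + bcost b s + t1"])
  next
    case False
    then show ?thesis using run.CondFalse[OF False run.Skip, of f "lp_com p"] LIf.prems bc
      by (auto intro!: exI[of _ "1 + bcost b s + 1"])
  qed
next
  case (LFor i m p)
  let ?F = "\<lambda>k s. exec f p (set_reg i k s)"
  let ?W = "While (BLess (NReg i) (NReg m)) (Then (lp_com p) (SetReg i (NAdd (NReg i) (NConst 1))))"
  let ?M = "reg s m"
  have im: "i \<noteq> m" "i \<notin> mregs p" "m \<notin> mregs p" "tame p" using LFor.prems by auto
  have MB: "?M \<le> B" using LFor.prems by simp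
  \<comment> \<open>Induction on the number \<open>j\<close> of rounds left, the counter standing at
    \<open>?M - j\<close>.\<close>
  have loop: "(\<exists>t \<le> 4 + 2 * B + j * (10 + 4 * B + time_ub p B).
      run f ?W (set_reg i (?M - j) s') t (set_reg i ?M (fold ?F [?M - j..<?M] s'))) \<and>
      (\<forall>x. reg (set_reg i ?M (fold ?F [?M - j..<?M] s')) x \<le> B)"
    if "j \<le> ?M" "reg s' m = ?M" "\<And>x. reg s' x \<le> B" for j s'
    using that
  proof (induction j arbitrary: s')
    case 0
    have "run f ?W (set_reg i ?M s') (1 + bcost (BLess (NReg i) (NReg m)) (set_reg i ?M s')) (set_reg i ?M s')"
      by (rule run.WhileFalse) (use 0 im in auto)
    moreover have "1 + bcost (BLess (NReg i) (NReg m)) (set_reg i ?M s') \<le> 4 + 2 * B + 0 * (10 + 4 * B + time_ub p B)"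
      using 0 MB im by simp
    ultimately have A: "\<exists>t \<le> 4 + 2 * B + 0 * (10 + 4 * B + time_ub p B). run f ?W (set_reg i ?M s') t (set_reg i ?M s')"
      by (intro exI conjI)
    have B: "\<forall>x. reg (set_reg i ?M s') x \<le> B" using 0 MB by simp
    have e: "?M - 0 = ?M" "[?M..<?M] = []" by simp_all
    show ?case unfolding e fold_simps(1) using A B by (rule conjI)
  next
    case (Suc j)
    let ?k = "?M - Suc j"
    let ?s = "set_reg i ?k s'"
    have k: "?k < ?M" "Suc ?k = ?M - j" using Suc.prems by auto
    have sB: "reg ?s x \<le> B" for x using Suc.prems k MB by auto
    obtain t1 where t1: "t1 \<le> time_ub p B" "run f (lp_com p) ?s t1 (exec f p ?s)"
      and B1: "\<And>x. reg (exec f p ?s) x \<le> B"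
      using LFor.IH[OF im(4) sB] by auto
    \<comment> \<open>\<open>tame\<close> guarantees that the body leaves counter and bound as they
      are.\<close>
    have ri: "reg (exec f p ?s) i = ?k" and rm: "reg (exec f p ?s) m = ?M"
      using im Suc.prems by (auto simp: exec_frame_reg)
    let ?s1 = "exec f p ?s"
    have inc: "run f (SetReg i (NAdd (NReg i) (NConst 1))) ?s1
        (1 + ncost (NAdd (NReg i) (NConst 1)) ?s1) (set_reg i (?M - j) ?s1)"
      using run.SetReg[of f i "NAdd (NReg i) (NConst 1)" ?s1] ri k by simp
    have "j \<le> ?M" using Suc.prems by simp
    from Suc.IH[OF this rm B1] obtain t2 where
      t2: "t2 \<le> 4 + 2 * B + j * (10 + 4 * B + time_ub p B)"
        "run f ?W (set_reg i (?M - j) ?s1) t2 (set_reg i ?M (fold ?F [?M - j..<?M] ?s1))"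
      and B2: "\<forall>x. reg (set_reg i ?M (fold ?F [?M - j..<?M] ?s1)) x \<le> B"
      by blast
    have fold: "fold ?F [?k..<?M] s' = fold ?F [?M - j..<?M] ?s1"
      using k by (simp add: upt_conv_Cons)
    have "bval (BLess (NReg i) (NReg m)) ?s" using k im Suc.prems by simp
    from run.WhileTrue[OF this run.Then[OF t1(2) inc] t2(2)]
    have r: "run f ?W ?s (1 + bcost (BLess (NReg i) (NReg m)) ?s +
        (t1 + (1 + ncost (NAdd (NReg i) (NConst 1)) ?s1)) + t2)
        (set_reg i ?M (fold ?F [?k..<?M] s'))" unfolding fold .
    have "1 + bcost (BLess (NReg i) (NReg m)) ?s +
        (t1 + (1 + ncost (NAdd (NReg i) (NConst 1)) ?s1)) + t2
        \<le> 4 + 2 * B + Suc j * (10 + 4 * B + time_ub p B)"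
      using t1(1) t2(1) k MB im Suc.prems ri by simp
    with r B2 show ?case unfolding fold by blast
  qed
  from loop[of ?M s] LFor.prems obtain t where
    t: "t \<le> 4 + 2 * B + ?M * (10 + 4 * B + time_ub p B)"
      "run f ?W (set_reg i 0 s) t (exec f (LFor i m p) s)"
    and BB: "\<forall>x. reg (exec f (LFor i m p) s) x \<le> B" by auto
  have "run f (SetReg i (NConst 0)) s 2 (set_reg i 0 s)"
    using run.SetReg[of f i "NConst 0" s] by (simp add: numeral_2_eq_2)
  from run.Then[OF this t(2)] have "run f (lp_com (LFor i m p)) s (2 + t) (exec f (LFor i m p) s)"
    by simp
  moreover have "2 + t \<le> time_ub (LFor i m p) B"
    unfolding time_ub.simps using t(1) mult_le_mono1[OF MB, of "10 + 4 * B + time_ub p B"] by linarith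
  ultimately show ?case using BB by blast
qed

section \<open>Functions of polynomial growth\<close>

definition poly_bounded :: "(nat \<Rightarrow> nat) \<Rightarrow> bool" where
  "poly_bounded T \<longleftrightarrow> (\<exists>a b. \<forall>B\<ge>1. T B \<le> a * B ^ b)"

lemma poly_bounded_const [intro, simp]: "poly_bounded (\<lambda>_. c)"
  unfolding poly_bounded_def by (rule exI[of _ c], rule exI[of _ 0]) simp

lemma poly_bounded_id [intro, simp]: "poly_bounded (\<lambda>B. B)"
  unfolding poly_bounded_def by (rule exI[of _ 1], rule exI[of _ 1]) simp

lemma poly_bounded_Suc_id [intro, simp]: "poly_bounded Suc"
  unfolding poly_bounded_def by (rule exI[of _ 2], rule exI[of _ 1]) simp

lemma poly_bounded_add [intro]:
  assumes "poly_bounded S" "poly_bounded T"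
  shows "poly_bounded (\<lambda>B. S B + T B)"
proof -
  obtain a b a' b' where 1: "\<forall>B\<ge>1. S B \<le> a * B ^ b" and 2: "\<forall>B\<ge>1. T B \<le> a' * B ^ b'"
    using assms unfolding poly_bounded_def by blast
  have "S B + T B \<le> (a + a') * B ^ (b + b')" if "1 \<le> B" for B
  proof -
    \<comment> \<open>Both exponents are raised to their sum, which is monotone because
      \<open>B \<ge> 1\<close>.\<close>
    have "a * B ^ b \<le> a * B ^ (b + b')" "a' * B ^ b' \<le> a' * B ^ (b + b')"
      using that by (auto intro!: mult_le_mono power_increasing)
    then show ?thesis using 1 2 that by (metis add_mono_thms_linordered_semiring(1) le_trans ring_distribs(2))
  qed
  then show ?thesis unfolding poly_bounded_def by blast
qed

lemma poly_bounded_mult [intro]: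
  assumes "poly_bounded S" "poly_bounded T"
  shows "poly_bounded (\<lambda>B. S B * T B)"
proof -
  obtain a b a' b' where 1: "\<forall>B\<ge>1. S B \<le> a * B ^ b" and 2: "\<forall>B\<ge>1. T B \<le> a' * B ^ b'"
    using assms unfolding poly_bounded_def by blast
  have "S B * T B \<le> (a * a') * B ^ (b + b')" if "1 \<le> B" for B
    using mult_le_mono[of "S B" "a * B ^ b" "T B" "a' * B ^ b'"] 1 2 that
    by (simp add: power_add algebra_simps)
  then show ?thesis unfolding poly_bounded_def by blast
qed

lemma poly_bounded_Suc [intro]: "poly_bounded T \<Longrightarrow> poly_bounded (\<lambda>B. Suc (T B))"
  using poly_bounded_add[OF poly_bounded_const[of 1], of T] by simp

lemma poly_bounded_nval: "poly_bounded (nval_ub e)"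
  by (induction e) auto

lemma poly_bounded_ncost: "poly_bounded (ncost_ub e)"
  by (induction e) (auto intro!: poly_bounded_Suc poly_bounded_add poly_bounded_mult simp: poly_bounded_nval)

lemma poly_bounded_ccost: "poly_bounded (ccost_ub e)"
  by (induction e) (auto intro!: poly_bounded_Suc poly_bounded_add simp: poly_bounded_ncost)

lemma poly_bounded_bcost: "poly_bounded (bcost_ub e)"
  by (induction e) (auto intro!: poly_bounded_Suc poly_bounded_add simp: poly_bounded_ncost poly_bounded_ccost)

lemma poly_bounded_time: "poly_bounded (time_ub p)"
  by (induction p) (auto intro!: poly_bounded_Suc poly_bounded_add poly_bounded_mult
      simp: poly_bounded_ncost poly_bounded_ccost poly_bounded_bcost)

section \<open>The algorithm\<close>

text \<open>The cells \<open>a[0]\<close> and \<open>b[0]\<close> carry the running powers of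
  \<open>tu\<close> and \<open>tv\<close> as complex numbers, since natural numbers of this size
  would be charged in unary.\<close>

definition point_prog :: loop_prog where
  "point_prog =
     LElem ''a'' (NConst 0) (COfNat (NConst 1)) ;;
     LElem ''b'' (NConst 0) (COfNat (NConst 1)) ;;
     LFor ''i'' ''n''
       (LElem ''x'' (NReg ''i'')
          (CAdd (CElem ''a'' (NConst 0)) (CMul (COfNat (NReg ''l'')) (CElem ''b'' (NConst 0)))) ;;
        LElem ''a'' (NConst 0) (CMul (CElem ''a'' (NConst 0)) (COfNat (NReg ''tu''))) ;;
        LElem ''b'' (NConst 0) (CMul (CElem ''b'' (NConst 0)) (COfNat (NReg ''tv''))))"

lemma point_prog:
  assumes "i < reg s ''n''"
  shows "arr (exec f point_prog s) ''x'' i =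
    of_nat (reg s ''tu'') ^ i + of_nat (reg s ''l'') * of_nat (reg s ''tv'') ^ i"
proof -
  have "\<forall>i<reg s ''n''. arr (exec f point_prog s) ''x'' i =
    of_nat (reg s ''tu'') ^ i + of_nat (reg s ''l'') * of_nat (reg s ''tv'') ^ i"
    unfolding point_prog_def exec_Seq
    by (rule exec_For[where M = "reg s ''n''" and I = "\<lambda>k s'. reg s' ''l'' = reg s ''l'' \<and>
        reg s' ''tu'' = reg s ''tu'' \<and> reg s' ''tv'' = reg s ''tv'' \<and>
        arr s' ''a'' 0 = of_nat (reg s ''tu'') ^ k \<and> arr s' ''b'' 0 = of_nat (reg s ''tv'') ^ k \<and>
        (\<forall>i<k. arr s' ''x'' i =
           of_nat (reg s ''tu'') ^ i + of_nat (reg s ''l'') * of_nat (reg s ''tv'') ^ i)"])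
      (auto simp: less_Suc_eq)
  then show ?thesis using assms by blast
qed

definition row_prog :: loop_prog where
  "row_prog =
     LElem ''y'' (NReg ''i'') (COfNat (NConst 0)) ;;
     LFor ''j'' ''n''
       (LElem ''y'' (NReg ''i'') (CAdd (CElem ''y'' (NReg ''i''))
          (CMul (CElem ''out'' (NAdd (NMul (NReg ''q'') (NReg ''nn'')) (NAdd (NMul (NReg ''i'') (NReg ''n'')) (NReg ''j''))))
             (CElem ''x'' (NReg ''j'')))))"

lemma row_prog:
  "arr (exec f row_prog s) ''y'' = (arr s ''y'')(reg s ''i'' := \<Sum>j<reg s ''n''.
      arr s ''out'' (reg s ''q'' * reg s ''nn'' + (reg s ''i'' * reg s ''n'' + j)) * arr s ''x'' j)"
  unfolding row_prog_def exec_Seq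
  by (rule exec_For[where M = "reg s ''n''" and I = "\<lambda>k s'. reg s' ''i'' = reg s ''i'' \<and>
      reg s' ''n'' = reg s ''n'' \<and> reg s' ''q'' = reg s ''q'' \<and> reg s' ''nn'' = reg s ''nn'' \<and>
      arr s' ''x'' = arr s ''x'' \<and> arr s' ''out'' = arr s ''out'' \<and>
      arr s' ''y'' = (arr s ''y'')(reg s ''i'' := \<Sum>j<k.
      arr s ''out'' (reg s ''q'' * reg s ''nn'' + (reg s ''i'' * reg s ''n'' + j)) * arr s ''x'' j)"])
    auto

lemma row_prog_mods [simp]: "mregs row_prog = {''j''}" "marrs row_prog = {''y''}"
  by (auto simp: row_prog_def)

definition image_prog :: loop_prog where
  "image_prog = LFor ''i'' ''n'' row_prog"

lemma image_prog:
  assumes "i < reg s ''n''"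
  shows "arr (exec f image_prog s) ''y'' i =
    (\<Sum>j<reg s ''n''. arr s ''out'' (reg s ''q'' * reg s ''nn'' + (i * reg s ''n'' + j)) * arr s ''x'' j)"
proof -
  have "\<forall>i<reg s ''n''. arr (exec f image_prog s) ''y'' i =
      (\<Sum>j<reg s ''n''. arr s ''out'' (reg s ''q'' * reg s ''nn'' + (i * reg s ''n'' + j)) * arr s ''x'' j)"
    unfolding image_prog_def
    by (rule exec_For[where M = "reg s ''n''" and I = "\<lambda>k s'.
      reg s' ''n'' = reg s ''n'' \<and> reg s' ''q'' = reg s ''q'' \<and> reg s' ''nn'' = reg s ''nn'' \<and>
      arr s' ''x'' = arr s ''x'' \<and> arr s' ''out'' = arr s ''out'' \<and>
      (\<forall>i<k. arr s' ''y'' i =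
        (\<Sum>j<reg s ''n''. arr s ''out'' (reg s ''q'' * reg s ''nn'' + (i * reg s ''n'' + j)) * arr s ''x'' j))"])
      (auto simp: row_prog exec_frame_reg exec_frame_arr less_Suc_eq)
  then show ?thesis using assms by blast
qed

definition shift_prog :: loop_prog where
  "shift_prog = LFor ''i'' ''n'' (LElem ''z'' (NReg ''i'')
     (CAdd (CElem ''x'' (NReg ''i''))
       (CMul (COfNat (NAdd (NReg ''k'') (NConst 1))) (CElem ''y'' (NReg ''i'')))))"

lemma shift_prog:
  assumes "i < reg s ''n''"
  shows "arr (exec f shift_prog s) ''z'' i = arr s ''x'' i + of_nat (Suc (reg s ''k'')) * arr s ''y'' i"
proof -
  have "\<forall>i<reg s ''n''. arr (exec f shift_prog s) ''z'' i = arr s ''x'' i + of_nat (Suc (reg s ''k'')) * arr s ''y'' i"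
    unfolding shift_prog_def
    by (rule exec_For[where M = "reg s ''n''" and I = "\<lambda>k s'. reg s' ''k'' = reg s ''k'' \<and>
      arr s' ''x'' = arr s ''x'' \<and> arr s' ''y'' = arr s ''y'' \<and>
      (\<forall>i<k. arr s' ''z'' i = arr s ''x'' i + of_nat (Suc (reg s ''k'')) * arr s ''y'' i)"])
      (auto simp: less_Suc_eq)
  then show ?thesis using assms by blast
qed

text \<open>After \<open>k\<close> steps, \<open>c\<close> holds \<open>(-1)\<^sup>k\<^sup>+\<^sup>1\<close> times the binomial coefficient of \<open>d\<close> over \<open>k\<close>. It is kept as a complex
  number, since natural numbers of this size would be too expensive.\<close>

definition interpolation_step :: loop_prog where
  "interpolation_step =
     LElem ''c'' (NConst 0) (CMul (CElem ''c'' (NConst 0))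
       (CDiv (CSub (COfNat (NReg ''k'')) (COfNat (NReg ''d''))) (COfNat (NAdd (NReg ''k'') (NConst 1))))) ;;
     shift_prog ;;
     LQuery ''h'' (NConst 0) ''z'' ;;
     LElem ''acc'' (NConst 0) (CAdd (CElem ''acc'' (NConst 0)) (CMul (CElem ''c'' (NConst 0))
       (CDiv (CSub (CElem ''h'' (NConst 0)) (CElem ''g'' (NConst 0))) (COfNat (NAdd (NReg ''k'') (NConst 1))))))"

text \<open>Starting \<open>c\<close> at -1 makes its value after the update in round
  \<open>k\<close> equal to \<open>(-1) ^ k * (d choose Suc k)\<close>, the weight in
  \<open>interpolated_deriv\<close>.\<close>

definition interpolation_prog :: loop_prog where
  "interpolation_prog =
     LQuery ''g'' (NConst 0) ''x'' ;;
     LElem ''acc'' (NConst 0) (COfNat (NConst 0)) ;;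
     LElem ''c'' (NConst 0) (CSub (COfNat (NConst 0)) (COfNat (NConst 1))) ;;
     LFor ''k'' ''d'' interpolation_step"

lemma shift_prog_mods [simp]: "mregs shift_prog = {''i''}" "marrs shift_prog = {''z''}"
  by (auto simp: shift_prog_def)

text \<open>The program fills only the first \<open>n\<close> entries of a queried array; the black
  box must ignore whatever stands behind them.\<close>

definition depends_only :: "nat \<Rightarrow> ((nat \<Rightarrow> complex) \<Rightarrow> complex) \<Rightarrow> bool" where
  "depends_only n f \<longleftrightarrow> (\<forall>x y. (\<forall>i<n. x i = y i) \<longrightarrow> f x = f y)"

lemma depends_onlyD: "depends_only n f \<Longrightarrow> (\<And>i. i < n \<Longrightarrow> x i = y i) \<Longrightarrow> f x = f y"
  by (simp add: depends_only_def)

lemma interpolation_prog: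
  assumes f: "depends_only n f"
    and n: "n = reg s ''n''" and d: "d = reg s ''d''"
    and y: "\<And>i. i < n \<Longrightarrow> arr s ''y'' i = (\<Sum>j<n. w (i * n + j) * arr s ''x'' j)"
  shows "arr (exec f interpolation_prog s) ''acc'' 0 = interpolated_deriv f n d (arr s ''x'') w"
proof -
  define x where "x = arr s ''x''"
  define y where "y = arr s ''y''"
  have y': "y i = (\<Sum>j<n. w (i * n + j) * x j)" if "i < n" for i using y[OF that] by (simp add: x_def y_def)
  define T where "T k = (-1) ^ k * of_nat (d choose Suc k) *
     ((f (\<lambda>i. x i + of_nat (Suc k) * y i) - f x) / of_nat (Suc k))" for k
  define I where "I k s' \<longleftrightarrow> reg s' ''n'' = n \<and> reg s' ''d'' = d \<and> arr s' ''x'' = x \<and>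
      arr s' ''y'' = y \<and> arr s' ''g'' 0 = f x \<and> arr s' ''c'' 0 = - ((-1) ^ k * of_nat (d choose k)) \<and>
      arr s' ''acc'' 0 = (\<Sum>k<k. T k)" for k and s' :: state
  have step: "I (Suc k) (exec f interpolation_step (set_reg ''k'' k s'))" if "k < d" "I k s'" for k s'
  proof -
    let ?s = "set_reg ''k'' k s'"
    let ?c = "- ((-1) ^ k * of_nat (d choose k)) * ((of_nat k - of_nat d) / of_nat (Suc k)) :: complex"
    let ?s1 = "set_arr ''c'' 0 ?c ?s"
    have s': "reg s' ''n'' = n" "reg s' ''d'' = d" "arr s' ''x'' = x" "arr s' ''y'' = y" "arr s' ''g'' 0 = f x"
      "arr s' ''c'' 0 = - ((-1) ^ k * of_nat (d choose k))" "arr s' ''acc'' 0 = (\<Sum>k<k. T k)"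
      using that by (auto simp: I_def)
    have c: "?c = - ((-1) ^ Suc k * of_nat (d choose Suc k))"
      unfolding alternating_binomial_Suc by simp
    \<comment> \<open>\<open>shift_prog\<close> determines only the first \<open>n\<close> entries
      of the queried array.\<close>
    have z: "f (arr (exec f shift_prog ?s1) ''z'') = f (\<lambda>i. x i + of_nat (Suc k) * y i)"
      by (rule depends_onlyD[OF f]) (use shift_prog[of _ ?s1 f] s' in simp)
    have "exec f interpolation_step ?s =
      (let s2 = set_arr ''h'' 0 (f (\<lambda>i. x i + of_nat (Suc k) * y i)) (exec f shift_prog ?s1)
       in set_arr ''acc'' 0 ((\<Sum>k<k. T k) + ?c * ((f (\<lambda>i. x i + of_nat (Suc k) * y i) - f x) / of_nat (Suc k))) s2)"
      unfolding interpolation_step_def Let_def z[symmetric] using s'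
      by (simp add: exec_frame_arr exec_frame_reg)
    then show ?thesis unfolding c using s' by (simp add: I_def T_def exec_frame_reg exec_frame_arr)
  qed
  have "arr (exec f interpolation_prog s) ''acc'' 0 = (\<Sum>k<d. T k)"
    unfolding interpolation_prog_def exec_Seq
    by (rule exec_For[where M = d and I = I]) (auto simp: step d n x_def y_def I_def[of 0] I_def[of "reg s ''d''"])
  also have "\<dots> = interpolated_deriv f n d x w"
  proof -
    have "f (\<lambda>i. x i + of_nat (Suc k) * y i) = f (\<lambda>i. x i + of_nat (Suc k) * (\<Sum>j<n. w (i * n + j) * x j))" for k
      by (rule depends_onlyD[OF f]) (simp add: y')
    then show ?thesis by (simp add: interpolated_deriv_def T_def)
  qed
  finally show ?thesis by (simp add: x_def)
qed


lemma point_prog_mods [simp]: "mregs point_prog = {''i''}" "marrs point_prog = {''a'', ''b'', ''x''}"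
  by (auto simp: point_prog_def)

lemma image_prog_mods [simp]: "mregs image_prog = {''i'', ''j''}" "marrs image_prog = {''y''}"
  by (auto simp: image_prog_def)

lemma interpolation_prog_mods [simp]: "mregs interpolation_prog = {''i'', ''k''}"
  "marrs interpolation_prog = {''z'', ''g'', ''h'', ''acc'', ''c''}"
  by (auto simp: interpolation_prog_def interpolation_step_def)

definition eval_prog :: loop_prog where
  "eval_prog = image_prog ;; interpolation_prog ;; LElem ''val'' (NReg ''q'') (CElem ''acc'' (NConst 0))"

lemma eval_prog_mods [simp]: "mregs eval_prog = {''i'', ''j'', ''k''}"
  "marrs eval_prog = {''y'', ''z'', ''g'', ''h'', ''acc'', ''c'', ''val''}"
  by (auto simp: eval_prog_def)

lemma eval_prog:
  assumes f: "depends_only (reg s ''n'') f"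
  shows "arr (exec f eval_prog s) ''val'' = (arr s ''val'')(reg s ''q'' :=
    interpolated_deriv f (reg s ''n'') (reg s ''d'') (arr s ''x'') (\<lambda>e. arr s ''out'' (reg s ''q'' * reg s ''nn'' + e)))"
proof -
  let ?s1 = "exec f image_prog s"
  have "arr (exec f interpolation_prog ?s1) ''acc'' 0 = interpolated_deriv f (reg s ''n'') (reg s ''d'')
      (arr ?s1 ''x'') (\<lambda>e. arr s ''out'' (reg s ''q'' * reg s ''nn'' + e))"
    by (rule interpolation_prog) (simp_all add: f exec_frame_reg exec_frame_arr image_prog)
  then show ?thesis
    by (simp add: eval_prog_def exec_frame_reg exec_frame_arr)
qed

definition vals_prog :: loop_prog where
  "vals_prog = LFor ''q'' ''r'' eval_prog"

lemma vals_prog_mods [simp]: "mregs vals_prog = {''q'', ''i'', ''j'', ''k''}"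
  "marrs vals_prog = {''y'', ''z'', ''g'', ''h'', ''acc'', ''c'', ''val''}"
  by (auto simp: vals_prog_def)

lemma vals_prog:
  assumes f: "depends_only (reg s ''n'') f" and "q < reg s ''r''"
  shows "arr (exec f vals_prog s) ''val'' q =
    interpolated_deriv f (reg s ''n'') (reg s ''d'') (arr s ''x'') (\<lambda>e. arr s ''out'' (q * reg s ''nn'' + e))"
proof -
  have "\<forall>q<reg s ''r''. arr (exec f vals_prog s) ''val'' q =
    interpolated_deriv f (reg s ''n'') (reg s ''d'') (arr s ''x'') (\<lambda>e. arr s ''out'' (q * reg s ''nn'' + e))"
    unfolding vals_prog_def
    by (rule exec_For[where M = "reg s ''r''" and I = "\<lambda>k s'. reg s' ''n'' = reg s ''n'' \<and>
      reg s' ''d'' = reg s ''d'' \<and> reg s' ''nn'' = reg s ''nn'' \<and> arr s' ''x'' = arr s ''x'' \<and>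
      arr s' ''out'' = arr s ''out'' \<and> (\<forall>q<k. arr s' ''val'' q =
        interpolated_deriv f (reg s ''n'') (reg s ''d'') (arr s ''x'') (\<lambda>e. arr s ''out'' (q * reg s ''nn'' + e)))"])
      (auto simp: eval_prog f exec_frame_reg exec_frame_arr less_Suc_eq)
  then show ?thesis using assms(2) by blast
qed

section \<open>Choice of a pivot and elimination\<close>

definition pivot_prog :: loop_prog where
  "pivot_prog = LReg ''p'' (NConst 0) ;;
     LFor ''q'' ''r'' (LIf (BNot (BEq (CElem ''val'' (NReg ''q'')) (COfNat (NConst 0)))) (LReg ''p'' (NReg ''q'')))"

lemma pivot_prog_mods [simp]: "mregs pivot_prog = {''p'', ''q''}" "marrs pivot_prog = {}"
  by (auto simp: pivot_prog_def)

text \<open>The last nonzero value wins, and \<open>p\<close> stays 0 if there is none. With no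
  vectors left, \<open>p = 0\<close> is not below \<open>r\<close>, hence the disjunction.\<close>

lemma pivot_prog:
  "(reg (exec f pivot_prog s) ''p'' = 0 \<or> reg (exec f pivot_prog s) ''p'' < reg s ''r'') \<and>
   (\<forall>q<reg s ''r''. arr s ''val'' q \<noteq> 0 \<longrightarrow> arr s ''val'' (reg (exec f pivot_prog s) ''p'') \<noteq> 0)"
  unfolding pivot_prog_def exec_Seq
  by (rule exec_For[where M = "reg s ''r''" and I = "\<lambda>k s'. reg s' ''r'' = reg s ''r'' \<and>
     arr s' ''val'' = arr s ''val'' \<and> (reg s' ''p'' = 0 \<or> reg s' ''p'' < k) \<and>
     (\<forall>q<k. arr s ''val'' q \<noteq> 0 \<longrightarrow> arr s ''val'' (reg s' ''p'') \<noteq> 0)"])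
    (auto simp: less_Suc_eq)

definition block :: "nexp \<Rightarrow> nexp" where
  "block q = NAdd (NMul q (NReg ''nn'')) (NReg ''e'')"

lemma nval_block [simp]: "nval (block q) s = nval q s * reg s ''nn'' + reg s ''e''"
  by (simp add: block_def)

text \<open>By division with remainder different blocks are disjoint, so writing one vector leaves
  the others untouched.\<close>

lemma block_index_eq_iff:
  fixes e e' m q q' :: nat
  assumes "e < m" "e' < m"
  shows "q * m + e = q' * m + e' \<longleftrightarrow> q = q' \<and> e = e'"
proof
  assume *: "q * m + e = q' * m + e'"
  have "(q * m + e) div m = q" "(q' * m + e') div m = q'" using assms by (simp_all add: div_nat_eqI)
  then have "q = q'" using * by metis
  then show "q = q' \<and> e = e'" using * by simp
qed simp

text \<open>The reduction overwrites the pivot block while later blocks still use the pivot vector,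
  hence a copy.\<close>

definition save_prog :: loop_prog where
  "save_prog = LFor ''e'' ''nn'' (LElem ''pv'' (NReg ''e'') (CElem ''out'' (block (NReg ''p''))))"

lemma save_prog_mods [simp]: "mregs save_prog = {''e''}" "marrs save_prog = {''pv''}"
  by (auto simp: save_prog_def)

lemma save_prog:
  assumes "e < reg s ''nn''"
  shows "arr (exec f save_prog s) ''pv'' e = arr s ''out'' (reg s ''p'' * reg s ''nn'' + e)"
proof -
  have "\<forall>e<reg s ''nn''. arr (exec f save_prog s) ''pv'' e = arr s ''out'' (reg s ''p'' * reg s ''nn'' + e)"
    unfolding save_prog_def
    by (rule exec_For[where M = "reg s ''nn''" and I = "\<lambda>k s'. reg s' ''p'' = reg s ''p'' \<and>
      reg s' ''nn'' = reg s ''nn'' \<and> arr s' ''out'' = arr s ''out'' \<and>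
      (\<forall>e<k. arr s' ''pv'' e = arr s ''out'' (reg s ''p'' * reg s ''nn'' + e))"])
      (auto simp: less_Suc_eq)
  then show ?thesis using assms by blast
qed

definition reduce_prog :: loop_prog where
  "reduce_prog = LFor ''e'' ''nn'' (LElem ''out'' (block (NReg ''q''))
     (CSub (CElem ''out'' (block (NReg ''q'')))
       (CMul (CDiv (CElem ''val'' (NReg ''q'')) (CElem ''val'' (NReg ''p''))) (CElem ''pv'' (NReg ''e'')))))"

lemma reduce_prog_mods [simp]: "mregs reduce_prog = {''e''}" "marrs reduce_prog = {''out''}"
  by (auto simp: reduce_prog_def)

lemma reduce_prog:
  assumes "e < reg s ''nn''"
  shows "arr (exec f reduce_prog s) ''out'' (q * reg s ''nn'' + e) =
    (if q = reg s ''q'' then arr s ''out'' (q * reg s ''nn'' + e) -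
       arr s ''val'' q / arr s ''val'' (reg s ''p'') * arr s ''pv'' e
     else arr s ''out'' (q * reg s ''nn'' + e))"
proof -
  let ?m = "reg s ''nn''"
  have "\<forall>q. \<forall>e<?m. arr (exec f reduce_prog s) ''out'' (q * ?m + e) =
      (if q = reg s ''q'' then arr s ''out'' (q * ?m + e) -
         arr s ''val'' q / arr s ''val'' (reg s ''p'') * arr s ''pv'' e
       else arr s ''out'' (q * ?m + e))"
    unfolding reduce_prog_def
    by (rule exec_For[where M = "?m" and I = "\<lambda>k s'. reg s' ''p'' = reg s ''p'' \<and>
      reg s' ''q'' = reg s ''q'' \<and> reg s' ''nn'' = ?m \<and> arr s' ''val'' = arr s ''val'' \<and> arr s' ''pv'' = arr s ''pv'' \<and>
      (\<forall>q. \<forall>e<?m. arr s' ''out'' (q * ?m + e) =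
      (if q = reg s ''q'' \<and> e < k then arr s ''out'' (q * ?m + e) -
         arr s ''val'' q / arr s ''val'' (reg s ''p'') * arr s ''pv'' e
       else arr s ''out'' (q * ?m + e)))"])
      (auto simp: less_Suc_eq block_index_eq_iff)
  then show ?thesis using assms by blast
qed

definition move_prog :: loop_prog where
  "move_prog = LFor ''e'' ''nn'' (LElem ''out'' (block (NReg ''p'')) (CElem ''out'' (block (NReg ''r''))))"

lemma move_prog_mods [simp]: "mregs move_prog = {''e''}" "marrs move_prog = {''out''}"
  by (auto simp: move_prog_def)

lemma move_prog:
  assumes "e < reg s ''nn''"
  shows "arr (exec f move_prog s) ''out'' (q * reg s ''nn'' + e) =
    arr s ''out'' ((if q = reg s ''p'' then reg s ''r'' else q) * reg s ''nn'' + e)"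
proof -
  let ?m = "reg s ''nn''"
  have "\<forall>q. \<forall>e<?m. arr (exec f move_prog s) ''out'' (q * ?m + e) =
      arr s ''out'' ((if q = reg s ''p'' then reg s ''r'' else q) * ?m + e)"
    unfolding move_prog_def
    by (rule exec_For[where M = "?m" and I = "\<lambda>k s'. reg s' ''p'' = reg s ''p'' \<and>
      reg s' ''r'' = reg s ''r'' \<and> reg s' ''nn'' = ?m \<and>
      (\<forall>q. \<forall>e<?m. arr s' ''out'' (q * ?m + e) =
        arr s ''out'' ((if q = reg s ''p'' \<and> e < k then reg s ''r'' else q) * ?m + e))"])
      (auto simp: less_Suc_eq block_index_eq_iff)
  then show ?thesis using assms by blast
qed

text \<open>The reduction turns the pivot vector into 0; the last vector takes its place.\<close>

definition elim_prog :: loop_prog where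
  "elim_prog = save_prog ;; LFor ''q'' ''r'' reduce_prog ;;
     LReg ''r'' (NSub (NReg ''r'') (NConst 1)) ;; move_prog"

lemma elim_prog_mods [simp]: "mregs elim_prog = {''e'', ''q'', ''r''}" "marrs elim_prog = {''pv'', ''out''}"
  by (auto simp: elim_prog_def)

lemma elim_prog_length: "reg (exec f elim_prog s) ''r'' = reg s ''r'' - 1"
  unfolding elim_prog_def exec_Seq exec.simps(1) by (simp add: exec_frame_reg del: exec.simps)

text \<open>Position \<open>p\<close> receives the reduced last vector, which matches
  \<open>null_basis_pivot\<close> followed by \<open>null_basis_reindex\<close>.\<close>

lemma elim_prog:
  assumes e: "e < reg s ''nn''" and q: "q < reg s ''r'' - 1"
  shows "arr (exec f elim_prog s) ''out'' (q * reg s ''nn'' + e) =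
    (let q' = (if q = reg s ''p'' then reg s ''r'' - 1 else q)
     in arr s ''out'' (q' * reg s ''nn'' + e) -
        arr s ''val'' q' / arr s ''val'' (reg s ''p'') * arr s ''out'' (reg s ''p'' * reg s ''nn'' + e))"
proof -
  let ?m = "reg s ''nn''" and ?p = "reg s ''p''" and ?r = "reg s ''r''"
  let ?s1 = "exec f save_prog s"
  let ?s2 = "exec f (LFor ''q'' ''r'' reduce_prog) ?s1"
  define I where "I k s' \<longleftrightarrow> reg s' ''p'' = ?p \<and> reg s' ''r'' = ?r \<and> reg s' ''nn'' = ?m \<and>
      arr s' ''val'' = arr s ''val'' \<and> (\<forall>e<?m. arr s' ''pv'' e = arr s ''out'' (?p * ?m + e)) \<and>
      (\<forall>q. \<forall>e<?m. arr s' ''out'' (q * ?m + e) =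
      (if q < k then arr s ''out'' (q * ?m + e) -
         arr s ''val'' q / arr s ''val'' ?p * arr s ''out'' (?p * ?m + e)
       else arr s ''out'' (q * ?m + e)))" for k and s' :: state
  have "\<forall>q<?r. \<forall>e<?m. arr ?s2 ''out'' (q * ?m + e) =
      arr s ''out'' (q * ?m + e) - arr s ''val'' q / arr s ''val'' ?p * arr s ''out'' (?p * ?m + e)"
  proof (rule exec_For[where M = "?r" and I = I])
    show "I 0 ?s1" by (simp add: I_def exec_frame_reg exec_frame_arr save_prog)
    show "I (Suc k) (exec f reduce_prog (set_reg ''q'' k s'))" if "k < ?r" "I k s'" for k s'
    proof -
      have "arr (exec f reduce_prog (set_reg ''q'' k s')) ''out'' (q * ?m + e) =
          (if q < Suc k then arr s ''out'' (q * ?m + e) -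
             arr s ''val'' q / arr s ''val'' ?p * arr s ''out'' (?p * ?m + e)
           else arr s ''out'' (q * ?m + e))" if "e < ?m" for q e
        using reduce_prog[of e "set_reg ''q'' k s'" f q] \<open>I k s'\<close> that
        by (simp add: I_def less_Suc_eq)
      then show ?thesis using that by (simp add: I_def exec_frame_reg exec_frame_arr)
    qed
  qed (simp_all add: exec_frame_reg I_def)
  then have red: "arr ?s2 ''out'' (q * ?m + e) =
      arr s ''out'' (q * ?m + e) - arr s ''val'' q / arr s ''val'' ?p * arr s ''out'' (?p * ?m + e)"
    if "q < ?r" for q using e that by blast
  have s2: "reg ?s2 ''nn'' = ?m" "reg ?s2 ''p'' = ?p" "reg ?s2 ''r'' = ?r"
    by (simp_all add: exec_frame_reg del: exec.simps)
  have ex: "exec f elim_prog s = exec f move_prog (set_reg ''r'' (?r - 1) ?s2)"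
    using s2 by (simp add: elim_prog_def)
  have "arr (exec f elim_prog s) ''out'' (q * ?m + e) =
      arr ?s2 ''out'' ((if q = ?p then ?r - 1 else q) * ?m + e)"
    unfolding ex using move_prog[of e "set_reg ''r'' (?r - 1) ?s2" f q] e s2 by (simp del: exec.simps)
  then show "arr (exec f elim_prog s) ''out'' (q * ?m + e) =
    (let q' = (if q = ?p then ?r - 1 else q)
     in arr s ''out'' (q' * ?m + e) - arr s ''val'' q' / arr s ''val'' ?p * arr s ''out'' (?p * ?m + e))"
    using red[of "if q = ?p then ?r - 1 else q"] q unfolding Let_def by (simp only: split: if_splits) auto
qed

text \<open>When no vector is left, \<open>vals_prog\<close> writes no value and
  \<open>val[0]\<close> may be stale; hence the test \<open>0 < r\<close>.\<close>

definition step_prog :: loop_prog where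
  "step_prog = point_prog ;; vals_prog ;; pivot_prog ;;
     LIf (BAnd (BLess (NConst 0) (NReg ''r'')) (BNot (BEq (CElem ''val'' (NReg ''p'')) (COfNat (NConst 0)))))
       elim_prog"

lemma step_prog_mods [simp]: "mregs step_prog = {''i'', ''q'', ''j'', ''k'', ''p'', ''e'', ''r''}"
  by (auto simp: step_prog_def)

definition out_vec :: "nat \<Rightarrow> state \<Rightarrow> nat \<Rightarrow> nat \<Rightarrow> complex" where
  "out_vec m s q e = arr s ''out'' (q * m + e)"

text \<open>The invariant of the search; \<open>\<Phi>\<close> collects the functionals of the
  points already processed.\<close>

definition basis_state :: "nat \<Rightarrow> nat \<Rightarrow> nat \<Rightarrow> (nat \<Rightarrow> complex) set \<Rightarrow> state \<Rightarrow> bool" where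
  "basis_state n d N \<Phi> s \<longleftrightarrow> reg s ''n'' = n \<and> reg s ''d'' = d \<and> reg s ''N'' = N \<and> reg s ''nn'' = n * n \<and>
     null_basis (n * n) \<Phi> {..<reg s ''r''} (out_vec (n * n) s)"

lemma basis_state_set_reg [simp]:
  "x \<notin> {''n'', ''d'', ''N'', ''nn'', ''r''} \<Longrightarrow> basis_state n d N \<Phi> (set_reg x k s) = basis_state n d N \<Phi> s"
  by (auto simp: basis_state_def out_vec_def[abs_def])

lemma interpolated_deriv_cong:
  assumes f: "depends_only n f" and x: "\<And>i. i < n \<Longrightarrow> x i = y i"
  shows "interpolated_deriv f n d x w = interpolated_deriv f n d y w"
proof -
  have "f x = f y" by (rule depends_onlyD[OF f x])
  moreover have "f (\<lambda>i. x i + of_nat (Suc k) * (\<Sum>j<n. w (i * n + j) * x j)) =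
     f (\<lambda>i. y i + of_nat (Suc k) * (\<Sum>j<n. w (i * n + j) * y j))" for k
    by (rule depends_onlyD[OF f]) (simp add: x)
  ultimately show ?thesis by (simp add: interpolated_deriv_def)
qed

abbreviation curve_point :: "nat \<Rightarrow> nat \<Rightarrow> nat \<Rightarrow> nat \<Rightarrow> complex" where
  "curve_point u v l \<equiv> (\<lambda>i. of_nat u ^ i + of_nat l * of_nat v ^ i)"

lemma bij_betw_replace_last:
  fixes p r :: nat
  assumes "p < r"
  shows "bij_betw (\<lambda>q. if q = p then r - 1 else q) {..<r - 1} ({..<r} - {p})"
  by (rule bij_betw_byWitness[where f' = "\<lambda>q. if q = r - 1 then p else q"]) (use assms in auto)

text \<open>Either all values vanish and the basis already satisfies the new equation, or the pivot
  exchange yields a basis of the smaller space. \<open>deriv\<close> identifies the numbers computed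
  from the black box with values of a linear functional.\<close>

lemma step_prog:
  assumes f: "depends_only n f"
    and deriv: "\<And>x w. interpolated_deriv f n d x w = lval (n * n) (\<phi> x) w"
    and inv: "basis_state n d N \<Phi> s"
  shows "basis_state n d N (insert (\<phi> (curve_point (reg s ''tu'') (reg s ''tv'') (reg s ''l''))) \<Phi>)
    (exec f step_prog s)"
proof -
  define \<psi> where "\<psi> = \<phi> (curve_point (reg s ''tu'') (reg s ''tv'') (reg s ''l''))"
  define s1 where "s1 = exec f point_prog s"
  define s2 where "s2 = exec f vals_prog s1"
  define s3 where "s3 = exec f pivot_prog s2"
  define B where "B = out_vec (n * n) s"
  define r where "r = reg s ''r''"
  define p where "p = reg s3 ''p''"
  define v where "v = arr s3 ''val''"
  note frames = exec_frame_reg exec_frame_arr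
  have regs: "reg s ''n'' = n" "reg s ''d'' = d" "reg s ''N'' = N" "reg s ''nn'' = n * n"
    and nb: "null_basis (n * n) \<Phi> {..<r} B"
    using inv by (auto simp: basis_state_def B_def r_def)
  have s3: "reg s3 ''n'' = n" "reg s3 ''d'' = d" "reg s3 ''N'' = N" "reg s3 ''nn'' = n * n" "reg s3 ''r'' = r"
    "arr s3 ''out'' = arr s ''out''"
    using regs by (simp_all add: s3_def s2_def s1_def frames r_def)
  have v: "v q = lval (n * n) \<psi> (B q)" if "q < r" for q
  proof -
    have "v q = arr s2 ''val'' q" by (simp add: v_def s3_def frames)
    also have "\<dots> = interpolated_deriv f n d (arr s1 ''x'') (B q)"
      using vals_prog[of s1 f q] f that regs
      by (simp add: s2_def s1_def frames r_def B_def out_vec_def[abs_def])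
    \<comment> \<open>Only the first \<open>n\<close> entries of \<open>x\<close> are known to be
      those of the curve point.\<close>
    also have "\<dots> = interpolated_deriv f n d (curve_point (reg s ''tu'') (reg s ''tv'') (reg s ''l'')) (B q)"
      by (rule interpolated_deriv_cong[OF f]) (simp add: s1_def point_prog regs)
    finally show ?thesis by (simp add: deriv \<psi>_def)
  qed
  have piv: "p = 0 \<or> p < r" "\<And>q. q < r \<Longrightarrow> v q \<noteq> 0 \<Longrightarrow> v p \<noteq> 0"
  proof -
    have "arr s2 ''val'' = v" "reg s2 ''r'' = r"
      by (simp_all add: v_def s3_def s2_def s1_def frames r_def)
    then show "p = 0 \<or> p < r" "\<And>q. q < r \<Longrightarrow> v q \<noteq> 0 \<Longrightarrow> v p \<noteq> 0"
      using pivot_prog[of f s2] by (auto simp: p_def s3_def)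
  qed
  show ?thesis
  proof (cases "0 < r \<and> v p \<noteq> 0")
    case False
    then have ex: "exec f step_prog s = s3"
      using s3 by (auto simp: step_prog_def s3_def s2_def s1_def p_def v_def)
    \<comment> \<open>By the choice of the pivot, a pivot value 0 means that all values are
      0.\<close>
    have "lval (n * n) \<psi> (B q) = 0" if "q < r" for q
      using v[OF that] piv(2)[OF that] False that by auto
    then have "null_basis (n * n) (insert \<psi> \<Phi>) {..<r} B"
      using null_basis_insert_zero[OF nb] by simp
    then show ?thesis unfolding ex basis_state_def using s3 by (simp add: \<psi>_def B_def out_vec_def[abs_def])
  next
    case True
    then have pr: "p < r" using piv by auto
    have ex: "exec f step_prog s = exec f elim_prog s3"
      using s3 True by (auto simp: step_prog_def s3_def s2_def s1_def p_def v_def)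
    let ?\<sigma> = "\<lambda>q. if q = p then r - 1 else q"
    have "null_basis (n * n) (insert \<psi> \<Phi>) ({..<r} - {p})
        (\<lambda>q e. B q e - lval (n * n) \<psi> (B q) / lval (n * n) \<psi> (B p) * B p e)"
      by (rule null_basis_pivot[OF nb]) (use pr True v[OF pr] in auto)
    from null_basis_reindex[OF this bij_betw_replace_last[OF pr]]
    have nb': "null_basis (n * n) (insert \<psi> \<Phi>) {..<r - 1}
        (\<lambda>q e. B (?\<sigma> q) e - lval (n * n) \<psi> (B (?\<sigma> q)) / lval (n * n) \<psi> (B p) * B p e)" .
    have "B (?\<sigma> q) e - lval (n * n) \<psi> (B (?\<sigma> q)) / lval (n * n) \<psi> (B p) * B p e =
        out_vec (n * n) (exec f elim_prog s3) q e"
      if "q \<in> {..<r - 1}" "e < n * n" for q e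
    proof -
      have "?\<sigma> q < r" using that pr by auto
      then show ?thesis
        using elim_prog[of e s3 q f] that s3 v[OF pr] v[of "?\<sigma> q"]
        by (simp add: Let_def out_vec_def B_def p_def v_def split: if_splits)
    qed
    from null_basis_cong[OF this nb']
    have nb2: "null_basis (n * n) (insert \<psi> \<Phi>) {..<r - 1} (out_vec (n * n) (exec f elim_prog s3))" .
    have "reg (exec f elim_prog s3) ''r'' = r - 1"
      using elim_prog_length[of f s3] s3 by simp
    then show ?thesis unfolding ex basis_state_def using s3 nb2 by (simp add: \<psi>_def frames)
  qed
qed

section \<open>The search over all points\<close>

definition scale_loop :: loop_prog where "scale_loop = LFor ''l'' ''N'' step_prog"
definition direction_loop :: loop_prog where "direction_loop = LFor ''tv'' ''N'' scale_loop"
definition search_prog :: loop_prog where "search_prog = LFor ''tu'' ''N'' direction_loop"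

lemma loop_mods [simp]:
  "mregs scale_loop = insert ''l'' (mregs step_prog)" "mregs direction_loop = insert ''tv'' (mregs scale_loop)"
  by (simp_all add: scale_loop_def direction_loop_def)

lemma basis_state_bound: "basis_state n d N \<Phi> s \<Longrightarrow> reg s ''N'' = N"
  by (simp add: basis_state_def)

lemma scale_loop:
  assumes f: "depends_only n f"
    and deriv: "\<And>x w. interpolated_deriv f n d x w = lval (n * n) (\<phi> x) w"
    and inv: "basis_state n d N \<Phi> s"
  shows "basis_state n d N (\<Phi> \<union> (\<lambda>l. \<phi> (curve_point (reg s ''tu'') (reg s ''tv'') l)) ` {..<N})
    (exec f scale_loop s)"
  unfolding scale_loop_def
proof (rule exec_For[where M = N and I = "\<lambda>k s'. reg s' ''tu'' = reg s ''tu'' \<and> reg s' ''tv'' = reg s ''tv'' \<and>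
    basis_state n d N (\<Phi> \<union> (\<lambda>l. \<phi> (curve_point (reg s ''tu'') (reg s ''tv'') l)) ` {..<k}) s'"])
  fix k s' assume *: "reg s' ''tu'' = reg s ''tu'' \<and> reg s' ''tv'' = reg s ''tv'' \<and>
    basis_state n d N (\<Phi> \<union> (\<lambda>l. \<phi> (curve_point (reg s ''tu'') (reg s ''tv'') l)) ` {..<k}) s'"
  then show "reg (exec f step_prog (set_reg ''l'' k s')) ''tu'' = reg s ''tu'' \<and>
    reg (exec f step_prog (set_reg ''l'' k s')) ''tv'' = reg s ''tv'' \<and>
    basis_state n d N (\<Phi> \<union> (\<lambda>l. \<phi> (curve_point (reg s ''tu'') (reg s ''tv'') l)) ` {..<Suc k})
      (exec f step_prog (set_reg ''l'' k s'))"
    using step_prog[OF f deriv, of N "\<Phi> \<union> (\<lambda>l. \<phi> (curve_point (reg s ''tu'') (reg s ''tv'') l)) ` {..<k}" "set_reg ''l'' k s'"]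
    by (simp add: exec_frame_reg lessThan_Suc)
qed (use inv in \<open>simp_all add: basis_state_bound\<close>)

lemma direction_loop:
  assumes f: "depends_only n f"
    and deriv: "\<And>x w. interpolated_deriv f n d x w = lval (n * n) (\<phi> x) w"
    and inv: "basis_state n d N \<Phi> s"
  shows "basis_state n d N (\<Phi> \<union> (\<Union>v<N. (\<lambda>l. \<phi> (curve_point (reg s ''tu'') v l)) ` {..<N}))
    (exec f direction_loop s)"
  unfolding direction_loop_def
proof (rule exec_For[where M = N and I = "\<lambda>k s'. reg s' ''tu'' = reg s ''tu'' \<and>
    basis_state n d N (\<Phi> \<union> (\<Union>v<k. (\<lambda>l. \<phi> (curve_point (reg s ''tu'') v l)) ` {..<N})) s'"])
  fix k s' assume *: "reg s' ''tu'' = reg s ''tu'' \<and>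
    basis_state n d N (\<Phi> \<union> (\<Union>v<k. (\<lambda>l. \<phi> (curve_point (reg s ''tu'') v l)) ` {..<N})) s'"
  then show "reg (exec f scale_loop (set_reg ''tv'' k s')) ''tu'' = reg s ''tu'' \<and>
    basis_state n d N (\<Phi> \<union> (\<Union>v<Suc k. (\<lambda>l. \<phi> (curve_point (reg s ''tu'') v l)) ` {..<N}))
      (exec f scale_loop (set_reg ''tv'' k s'))"
    using scale_loop[OF f deriv, of N "\<Phi> \<union> (\<Union>v<k. (\<lambda>l. \<phi> (curve_point (reg s ''tu'') v l)) ` {..<N})" "set_reg ''tv'' k s'"]
    by (simp add: exec_frame_reg lessThan_Suc Un_ac)
qed (use inv in \<open>simp_all add: basis_state_bound\<close>)

lemma search_prog:
  assumes f: "depends_only n f"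
    and deriv: "\<And>x w. interpolated_deriv f n d x w = lval (n * n) (\<phi> x) w"
    and inv: "basis_state n d N \<Phi> s"
  shows "basis_state n d N (\<Phi> \<union> (\<Union>u<N. \<Union>v<N. (\<lambda>l. \<phi> (curve_point u v l)) ` {..<N}))
    (exec f search_prog s)"
  unfolding search_prog_def
proof (rule exec_For[where M = N and I = "\<lambda>k s'.
    basis_state n d N (\<Phi> \<union> (\<Union>u<k. \<Union>v<N. (\<lambda>l. \<phi> (curve_point u v l)) ` {..<N})) s'"])
  fix k s' assume *: "basis_state n d N (\<Phi> \<union> (\<Union>u<k. \<Union>v<N. (\<lambda>l. \<phi> (curve_point u v l)) ` {..<N})) s'"
  then show "basis_state n d N (\<Phi> \<union> (\<Union>u<Suc k. \<Union>v<N. (\<lambda>l. \<phi> (curve_point u v l)) ` {..<N}))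
      (exec f direction_loop (set_reg ''tu'' k s'))"
    using direction_loop[OF f deriv, of N "\<Phi> \<union> (\<Union>u<k. \<Union>v<N. (\<lambda>l. \<phi> (curve_point u v l)) ` {..<N})" "set_reg ''tu'' k s'"]
    by (simp add: lessThan_Suc Un_ac)
qed (use inv in \<open>simp_all add: basis_state_bound\<close>)

definition unit_prog :: loop_prog where
  "unit_prog = LFor ''q'' ''nn''
     (LElem ''out'' (NAdd (NMul (NReg ''q'') (NReg ''nn'')) (NReg ''q'')) (COfNat (NConst 1)))"

text \<open>Only the ones are written; the zeros come from the initial array.\<close>

lemma unit_prog:
  assumes "arr s ''out'' = (\<lambda>_. 0)" "q < reg s ''nn''" "e < reg s ''nn''"
  shows "arr (exec f unit_prog s) ''out'' (q * reg s ''nn'' + e) = (if q = e then 1 else 0)"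
proof -
  let ?m = "reg s ''nn''"
  have "\<forall>q<?m. \<forall>e<?m. arr (exec f unit_prog s) ''out'' (q * ?m + e) = (if q = e then 1 else 0)"
    unfolding unit_prog_def
  proof (rule exec_For[where M = ?m and I = "\<lambda>k s'. reg s' ''nn'' = ?m \<and> (\<forall>q. \<forall>e<?m.
          arr s' ''out'' (q * ?m + e) = (if q = e \<and> q < k then 1 else 0))"])
    show "reg s ''nn'' = ?m \<and> (\<forall>q. \<forall>e<?m. arr s ''out'' (q * ?m + e) = (if q = e \<and> q < 0 then 1 else 0))"
      by (simp add: assms(1))
  qed (auto simp: less_Suc_eq block_index_eq_iff)
  then show ?thesis using assms by blast
qed

definition main_prog :: loop_prog where
  "main_prog = unit_prog ;; search_prog"

definition bound_exp :: nexp where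
  "bound_exp = NAdd (NMul (NConst 2) (NMul (NMul (NReg ''d'') (NReg ''d'')) (NReg ''n''))) (NConst 2)"

text \<open>\<open>N\<close> and \<open>nn\<close> are computed outside \<open>main_prog\<close>,
  because sums and products are not \<open>flat\<close>; their values enter the register bound for
  the rest.\<close>

definition lie_program :: com where
  "lie_program = Then (SetReg ''N'' bound_exp) (Then (SetReg ''nn'' (NMul (NReg ''n'') (NReg ''n'')))
     (Then (SetReg ''r'' (NReg ''nn'')) (lp_com main_prog)))"

lemma tame_main_prog: "tame main_prog"
  by (simp add: main_prog_def unit_prog_def search_prog_def direction_loop_def scale_loop_def step_prog_def point_prog_def
      vals_prog_def eval_prog_def image_prog_def row_prog_def interpolation_prog_def interpolation_step_def
      shift_prog_def pivot_prog_def elim_prog_def save_prog_def reduce_prog_def move_prog_def)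

lemma main_prog_outputs_basis:
  assumes P: "P = (\<Prod>k<d. lform n (a k))" and nz: "\<And>k. k < d \<Longrightarrow> \<exists>i<n. a k i \<noteq> 0" and "1 \<le> d"
    and s: "reg s ''n'' = n" "reg s ''d'' = d" "reg s ''N'' = 2 * (d * d * n) + 2" "reg s ''nn'' = n * n"
      "reg s ''r'' = n * n" "arr s ''out'' = (\<lambda>_. 0)"
  shows "outputs_lie_algebra_basis n P (exec (meval P) main_prog s)"
proof -
  define N where "N = 2 * (d * d * n) + 2"
  let ?f = "meval P" and ?m = "n * n"
  let ?s = "exec ?f unit_prog s" and ?s' = "exec ?f main_prog s"
  let ?\<phi> = "lie_functional n P"
  let ?\<Phi> = "\<Union>u<N. \<Union>v<N. (\<lambda>l. ?\<phi> (curve_point u v l)) ` {..<N}"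
  have f: "depends_only n ?f"
    unfolding depends_only_def by (intro allI impI meval_lform_product_cong[OF P]) blast
  \<comment> \<open>As long as no condition is imposed, the unit matrices form a basis.\<close>
  have "null_basis ?m {} {..<?m} (out_vec ?m ?s)"
    by (rule null_basis_cong[OF _ null_basis_unit])
      (use unit_prog[of s _ _ ?f] s in \<open>simp add: out_vec_def\<close>)
  then have "basis_state n d N {} ?s"
    using s by (simp add: basis_state_def exec_frame_reg unit_prog_def N_def del: exec.simps)
  from search_prog[OF f interpolated_deriv_eq[OF P assms(3)] this]
  have "basis_state n d N ?\<Phi> ?s'" by (simp add: main_prog_def)
  then have nb: "null_basis ?m ?\<Phi> {..<reg ?s' ''r''} (out_vec ?m ?s')" by (simp add: basis_state_def)
  have lie: "C \<in> lie_algebra n P \<longleftrightarrow> (\<forall>\<phi>\<in>?\<Phi>. lval ?m \<phi> (flat_mat n C) = 0)" if "C \<in> carrier_mat n n" for C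
    using lie_algebra_iff_functionals[OF P nz assms(3) N_def that] by (simp add: ball_UN) (simp add: Ball_def)
  have out: "output_matrix n ?s' q = unflat n (out_vec ?m ?s' q)" for q
    by (rule eq_matI) (simp_all add: output_matrix_def out_vec_def add.assoc mult.assoc)
  show ?thesis
    using null_basis_imp_lie_algebra_basis[OF nb lie]
    unfolding outputs_lie_algebra_basis_def output_length_def out[abs_def] .
qed

section \<open>The overall running time\<close>

lemma poly_bounded_cube:
  assumes "poly_bounded T"
  obtains a b where "\<And>x. 1 \<le> x \<Longrightarrow> T (8 * x ^ 3) \<le> a * x ^ b"
proof -
  obtain a b where T: "\<And>B. 1 \<le> B \<Longrightarrow> T B \<le> a * B ^ b"
    using assms by (auto simp: poly_bounded_def)
  have "T (8 * x ^ 3) \<le> (a * 8 ^ b) * x ^ (3 * b)" if "1 \<le> x" for x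
    using T[of "8 * x ^ 3"] that by (simp add: power_mult_distrib power_mult mult.assoc)
  then show thesis using that by blast
qed

text \<open>One bound for \<open>N\<close>, for \<open>nn\<close> and for the inputs, hence for
  every register when \<open>main_prog\<close> starts.\<close>

lemma bound_exp_le:
  fixes n d :: nat
  assumes "1 \<le> d"
  shows "2 * (d * d * n) + 2 \<le> 8 * (n + d) ^ 3" "n * n \<le> 8 * (n + d) ^ 3" "n + d \<le> 8 * (n + d) ^ 3"
proof -
  define x where "x = n + d"
  have x: "1 \<le> x" "n \<le> x" "d \<le> x" using assms by (simp_all add: x_def)
  have c: "x ^ 3 = x * x * x" by (simp add: power3_eq_cube)
  have "d * d * n \<le> x ^ 3" unfolding c using x by (intro mult_le_mono)
  moreover have "1 \<le> x ^ 3" using x(1) by (rule one_le_power)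
  moreover have "n * n * 1 \<le> x ^ 3" unfolding c using x by (intro mult_le_mono)
  moreover have "x * 1 * 1 \<le> x ^ 3" unfolding c using x by (intro mult_le_mono) auto
  ultimately show "2 * (d * d * n) + 2 \<le> 8 * (n + d) ^ 3" "n * n \<le> 8 * (n + d) ^ 3" "n + d \<le> 8 * (n + d) ^ 3"
    unfolding x_def[symmetric] by linarith+
qed

text \<open>All registers stay below a cubic bound in \<open>n + d\<close>, and the time is
  polynomial in that bound. The program is fixed, so \<open>a\<close> and \<open>b\<close> do not
  depend on the input.\<close>

lemma lie_program_correct:
  "\<exists>a b. \<forall>n d P. total_degree P = d \<and> d \<ge> 1 \<and> product_of_linear_forms n P \<longrightarrow>
     (\<exists>t s. run (meval P) lie_program (init_state n d) t s \<and> t \<le> a * (n + d) ^ b \<and>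
        outputs_lie_algebra_basis n P s)"
proof -
  let ?sq = "NMul (NReg ''n'') (NReg ''n'')"
  define T where "T B = (1 + ncost_ub bound_exp B) + ((1 + ncost_ub ?sq B) +
      ((1 + ncost_ub (NReg ''nn'') B) + time_ub main_prog B))" for B
  have "poly_bounded T"
    unfolding T_def by (intro poly_bounded_add poly_bounded_const poly_bounded_ncost poly_bounded_time)
  then obtain a b where ab: "\<And>x. 1 \<le> x \<Longrightarrow> T (8 * x ^ 3) \<le> a * x ^ b"
    by (rule poly_bounded_cube) blast
  have "\<exists>t s. run (meval P) lie_program (init_state n d) t s \<and> t \<le> a * (n + d) ^ b \<and>
        outputs_lie_algebra_basis n P s"
    if d: "total_degree P = d" "d \<ge> 1" and pl: "product_of_linear_forms n P" for n d P
  proof -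
    obtain c where P: "P = (\<Prod>k<d. lform n (c k))" and nz: "\<And>k. k < d \<Longrightarrow> \<exists>i<n. c k i \<noteq> 0"
      using product_of_linear_forms_factors[OF pl] d by metis
    let ?f = "meval P"
    define B where "B = 8 * (n + d) ^ 3"
    define s0 where "s0 = init_state n d"
    define s1 where "s1 = set_reg ''N'' (nval bound_exp s0) s0"
    define s2 where "s2 = set_reg ''nn'' (nval ?sq s1) s1"
    define s3 where "s3 = set_reg ''r'' (nval (NReg ''nn'') s2) s2"
    note B = bound_exp_le[OF d(2), of n, folded B_def]
    have le: "reg s0 x \<le> B" "reg s1 x \<le> B" "reg s2 x \<le> B" "reg s3 x \<le> B" for x
      using B by (auto simp: s0_def s1_def s2_def s3_def init_state_def bound_exp_def)
    have B1: "1 \<le> B" using B(1) by linarith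
    obtain t where t: "t \<le> time_ub main_prog B" "run ?f (lp_com main_prog) s3 t (exec ?f main_prog s3)"
      using run_lp_com[OF tame_main_prog le(4) B1] by blast
    let ?t = "(1 + ncost bound_exp s0) + ((1 + ncost ?sq s1) + ((1 + ncost (NReg ''nn'') s2) + t))"
    have r1: "run ?f (SetReg ''N'' bound_exp) s0 (1 + ncost bound_exp s0) s1"
      unfolding s1_def by (rule run.SetReg)
    have r2: "run ?f (SetReg ''nn'' ?sq) s1 (1 + ncost ?sq s1) s2"
      unfolding s2_def by (rule run.SetReg)
    have r3: "run ?f (SetReg ''r'' (NReg ''nn'')) s2 (1 + ncost (NReg ''nn'') s2) s3"
      unfolding s3_def by (rule run.SetReg)
    have r: "run ?f lie_program (init_state n d) ?t (exec ?f main_prog s3)"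
      unfolding lie_program_def s0_def[symmetric] by (intro run.Then[OF r1] run.Then[OF r2] run.Then[OF r3] t(2))
    have "?t \<le> T B"
      unfolding T_def using t(1) by (intro add_mono ncost_le_ub le order_refl)
    also have "\<dots> \<le> a * (n + d) ^ b" unfolding B_def using d(2) by (intro ab) simp
    finally have "?t \<le> a * (n + d) ^ b" .
    moreover have "outputs_lie_algebra_basis n P (exec ?f main_prog s3)"
      by (rule main_prog_outputs_basis[OF P nz d(2)])
        (simp_all add: s3_def s2_def s1_def s0_def init_state_def bound_exp_def)
    ultimately show ?thesis using r by blast
  qed
  then show ?thesis by blast
qed

theorem theorem7p5:
  shows "(\<forall>(n::nat) (d::nat) (P::mpoly) (C::complex mat).
      mpoly_in n P \<and> total_degree P = d \<and> d \<ge> 1 \<and> product_of_linear_forms n P \<and>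
      C \<in> carrier_mat n n \<longrightarrow>
        (C \<in> lie_algebra n P \<longleftrightarrow>
          (\<forall>x \<in> Lambda_points d n.
             (\<Sum>i<n. \<Sum>j<n. C $$ (i, j) * x $ j * meval (mderiv i P) (\<lambda>k. x $ k)) = 0)))
    \<and> (\<exists>(prog::com) (a::nat) (b::nat). \<forall>(n::nat) (d::nat) (P::mpoly).
      mpoly_in n P \<and> total_degree P = d \<and> d \<ge> 1 \<and> product_of_linear_forms n P \<longrightarrow>
        (\<exists>t s. run (meval P) prog (init_state n d) t s \<and>
          t \<le> a * (n + d) ^ b \<and>
          outputs_lie_algebra_basis n P s))"
proof (intro conjI allI impI)
  show "C \<in> lie_algebra n P \<longleftrightarrow> (\<forall>x \<in> Lambda_points d n.
      (\<Sum>i<n. \<Sum>j<n. C $$ (i, j) * x $ j * meval (mderiv i P) (\<lambda>k. x $ k)) = 0)"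
    if "mpoly_in n P \<and> total_degree P = d \<and> d \<ge> 1 \<and> product_of_linear_forms n P \<and> C \<in> carrier_mat n n"
    for n d P C
    using mem_lie_algebra_iff_Lambda that by blast
  show "\<exists>prog a b. \<forall>n d P. mpoly_in n P \<and> total_degree P = d \<and> d \<ge> 1 \<and> product_of_linear_forms n P \<longrightarrow>
      (\<exists>t s. run (meval P) prog (init_state n d) t s \<and> t \<le> a * (n + d) ^ b \<and>
        outputs_lie_algebra_basis n P s)"
    using lie_program_correct by blast
qed

end
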